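(* Let $\phi\in\mathcal{S}(\mathbb{H})$ with $\int_{\mathbb{H}}\phi=0$. Then $\phi$ is admissible if and only if $\phi$ is Calderón admissible.
   Context: The Heisenberg group $\mathbb{H}$ is $\mathbb{R}^3$ with group law $(p_1,q_1,t_1)\ast(p_2,q_2,t_2)=\big(p_1+p_2,\,q_1+q_2,\,t_1+t_2+\tfrac12(p_1q_2-q_1p_2)\big)$; its Haar measure is Lebesgue measure on $\mathbb{R}^3$, and $\mathcal{S}(\mathbb{H})$ is the Schwartz space of $\mathbb{R}^3$. For $a>0$, the dilation automorphism is $a\cdot(p,q,t)=\delta_a(p,q,t)=(ap,aq,a^2t)$. Convolution is $(f\ast g)(\omega)=\int_{\mathbb{H}}f(\upsilon)\,g(\upsilon^{-1}\omega)\,d\upsilon$. For a function $\phi$ on $\mathbb{H}$ put $\tilde\phi(\omega)=\overline{\phi(\omega^{-1})}$ and, for $a>0$, $\phi_a(\omega)=a^{-4}\phi(a^{-1}\omega)$; here $\tilde\phi_a$ means $\widetilde{\phi_a}=(\tilde\phi)_a$. Let $G=\mathbb{H}\rtimes(0,\infty)$ with product $(\omega,a)(\omega',a')=(\omega\,(a\omega'),aa')$ and left Haar measure $d\mu_G(\omega,a)=a^{-5}\,d\omega\,da$. The quasi-regular representation $\pi$ of $G$ on $L^2(\mathbb{H})$ is $(\pi(\omega,a)f)(\upsilon)=a^{-2}f\big(a^{-1}(\omega^{-1}\upsilon)\big)$. Admissible: $\phi\in L^2(\mathbb{H})$ is called admissible if the operator $V_\phi f(\omega,a)=\langle f,\pi(\omega,a)\phi\rangle$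 maps $L^2(\mathbb{H})$ into $L^2(G)$ isometrically up to a constant, i.e. there is a positive constant $C_\phi$, depending only on $\phi$, such that $\|f\|_2^2=C_\phi\int_{\mathbb{H}}\int_0^\infty|V_\phi f(\omega,a)|^2a^{-5}\,da\,d\omega$ for all $f\in L^2(\mathbb{H})$. Calderón admissible: $\phi\in\mathcal{S}(\mathbb{H})$ with $\int\phi=0$ is called Calderón admissible if there is a nonzero constant $c$ such that for every $g\in\mathcal{S}(\mathbb{H})$, $$g\ast\int_\varepsilon^A\tilde\phi_a\ast\phi_a\,a^{-1}\,da\;\longrightarrow\;c\,g\quad\text{as }\varepsilon\to0,\ A\to\infty\qquad(0<\varepsilon<A<\infty)$$ in the sense of tempered distributions. *)

theory Defs
  imports "HOL-Analysis.Analysis"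
begin

subsection \<open>Schwartz functions and tempered convergence\<close>

definition partial_deriv :: "'a::euclidean_space \<Rightarrow> ('a \<Rightarrow> complex) \<Rightarrow> 'a \<Rightarrow> complex" where
  "partial_deriv b f x = frechet_derivative f (at x) b"

text \<open>Requiring every iterated partial derivative to be differentiable is smoothness; the case
  \<open>k = 0\<close> of the second condition bounds the derivatives themselves.\<close>

definition schwartz :: "('a::euclidean_space \<Rightarrow> complex) set" where
  "schwartz = {f. \<forall>bs\<in>lists Basis.
      (\<forall>x. foldr partial_deriv bs f differentiable (at x)) \<and>
      (\<forall>k::nat. bounded (range (\<lambda>x. norm x ^ k *\<^sub>R foldr partial_deriv bs f x)))}"

text \<open>A function is identified with the distribution \<open>\<psi> \<mapsto> \<integral> u \<psi>\<close>; convergence is pointwise on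
  test functions (the weak-star topology of the tempered distributions).\<close>

definition tempered_tendsto ::
    "('i \<Rightarrow> 'a::euclidean_space \<Rightarrow> complex) \<Rightarrow> ('a \<Rightarrow> complex) \<Rightarrow> 'i filter \<Rightarrow> bool" where
  "tempered_tendsto u v F \<longleftrightarrow>
     (\<forall>\<psi>\<in>schwartz. ((\<lambda>i. LINT x|lborel. u i x * \<psi> x) \<longlongrightarrow> (LINT x|lborel. v x * \<psi> x)) F)"

subsection \<open>Square-integrable functions\<close>

definition L2 :: "'a measure \<Rightarrow> ('a \<Rightarrow> complex) set" where
  "L2 M = {f \<in> borel_measurable M. integrable M (\<lambda>x. (cmod (f x))\<^sup>2)}"

definition L2_inner :: "'a measure \<Rightarrow> ('a \<Rightarrow> complex) \<Rightarrow> ('a \<Rightarrow> complex) \<Rightarrow> complex" where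
  "L2_inner M f g = (LINT x|M. f x * cnj (g x))"

definition L2_norm :: "'a measure \<Rightarrow> ('a \<Rightarrow> complex) \<Rightarrow> real" where
  "L2_norm M f = sqrt (LINT x|M. (cmod (f x))\<^sup>2)"

subsection \<open>The Heisenberg group\<close>

type_synonym heis = "real \<times> real \<times> real"

fun heis_mult :: "heis \<Rightarrow> heis \<Rightarrow> heis" where
  "heis_mult (p1, q1, t1) (p2, q2, t2) = (p1 + p2, q1 + q2, t1 + t2 + (p1 * q2 - q1 * p2) / 2)"

fun heis_inv :: "heis \<Rightarrow> heis" where
  "heis_inv (p, q, t) = (- p, - q, - t)"

lemma heis_group:
  "heis_mult (heis_mult x y) z = heis_mult x (heis_mult y z)"
  "heis_mult 0 x = x" "heis_mult x 0 = x"
  "heis_mult (heis_inv x) x = 0" "heis_mult x (heis_inv x) = 0"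
  by (cases x; cases y; cases z; simp add: zero_prod_def field_simps)+

fun dilation :: "real \<Rightarrow> heis \<Rightarrow> heis" where
  "dilation a (p, q, t) = (a * p, a * q, a\<^sup>2 * t)"

lemma dilation_mult: "dilation a (heis_mult x y) = heis_mult (dilation a x) (dilation a y)"
  by (cases x; cases y; simp add: field_simps power2_eq_square)

definition heis_conv :: "(heis \<Rightarrow> complex) \<Rightarrow> (heis \<Rightarrow> complex) \<Rightarrow> heis \<Rightarrow> complex" where
  "heis_conv f g \<omega> = (LINT \<upsilon>|lborel. f \<upsilon> * g (heis_mult (heis_inv \<upsilon>) \<omega>))"

definition tilde :: "(heis \<Rightarrow> complex) \<Rightarrow> heis \<Rightarrow> complex" where
  "tilde \<phi> \<omega> = cnj (\<phi> (heis_inv \<omega>))"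

definition dilate :: "real \<Rightarrow> (heis \<Rightarrow> complex) \<Rightarrow> heis \<Rightarrow> complex" where
  "dilate a \<phi> \<omega> = (1 / a ^ 4) *\<^sub>R \<phi> (dilation (1 / a) \<omega>)"

subsection \<open>The group \<open>H \<rtimes> (0, \<infinity>)\<close> and admissibility\<close>

definition haar_G :: "(heis \<times> real) measure" where
  "haar_G = density (restrict_space lborel (UNIV \<times> {0<..})) (\<lambda>(\<omega>, a). ennreal (1 / a ^ 5))"

fun quasi_regular :: "heis \<times> real \<Rightarrow> (heis \<Rightarrow> complex) \<Rightarrow> heis \<Rightarrow> complex" where
  "quasi_regular (\<omega>, a) f \<upsilon> =
     (1 / a\<^sup>2) *\<^sub>R f (dilation (1 / a) (heis_mult (heis_inv \<omega>) \<upsilon>))"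

definition wavelet_transform ::
    "(heis \<Rightarrow> complex) \<Rightarrow> (heis \<Rightarrow> complex) \<Rightarrow> heis \<times> real \<Rightarrow> complex" where
  "wavelet_transform \<phi> f x = L2_inner lborel f (quasi_regular x \<phi>)"

definition admissible :: "(heis \<Rightarrow> complex) \<Rightarrow> bool" where
  "admissible \<phi> \<longleftrightarrow> \<phi> \<in> L2 lborel \<and>
     (\<exists>C::real. C > 0 \<and> (\<forall>f\<in>L2 lborel.
        wavelet_transform \<phi> f \<in> L2 haar_G \<and>
        (L2_norm lborel f)\<^sup>2 =
          C * (LINT \<omega>|lborel. (LINT a:{0<..}|lborel.
                 (cmod (wavelet_transform \<phi> f (\<omega>, a)))\<^sup>2 * (1 / a ^ 5)))))"

definition calderon_kernel :: "(heis \<Rightarrow> complex) \<Rightarrow> real \<Rightarrow> real \<Rightarrow> heis \<Rightarrow> complex" where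
  "calderon_kernel \<phi> \<epsilon> A \<omega> =
     (LINT a:{\<epsilon>..A}|lborel. (1 / a) *\<^sub>R heis_conv (tilde (dilate a \<phi>)) (dilate a \<phi>) \<omega>)"

definition calderon_admissible :: "(heis \<Rightarrow> complex) \<Rightarrow> bool" where
  "calderon_admissible \<phi> \<longleftrightarrow> \<phi> \<in> schwartz \<and> (LINT \<omega>|lborel. \<phi> \<omega>) = 0 \<and>
     (\<exists>c::complex. c \<noteq> 0 \<and> (\<forall>g\<in>schwartz.
        tempered_tendsto (\<lambda>(\<epsilon>, A). heis_conv g (calderon_kernel \<phi> \<epsilon> A)) (\<lambda>\<omega>. c * g \<omega>)
          (at_right 0 \<times>\<^sub>F at_top)))"

end

theory Submission
  imports Defs "HOL-Probability.Sinc_Integral"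
begin

text \<open>
  Put \<open>W\<^sub>a g = g \<star> tilde (dilate a \<phi>)\<close>. The wavelet transform is \<open>V g (\<omega>, a) = a\<^sup>2 W\<^sub>a g \<omega>\<close>, and right
  convolution with \<open>dilate a \<phi>\<close> is the adjoint of \<open>W\<^sub>a\<close>. Since \<open>a\<^sup>4 a\<^sup>-\<^sup>5 da = da / a\<close>, pairing the
  convolution of \<open>g\<close> and the truncated Calderon kernel with a test function \<open>\<psi>\<close> gives the inner product of \<open>V g\<close>
  and \<open>V (cnj \<psi>)\<close> over the part \<open>\<epsilon> \<le> a \<le> A\<close> of \<open>G\<close> (\<open>calderon_kernel_pairing\<close>). Once this is known,
  the theorem compares two ways of saying that \<open>V\<close> is a multiple of an isometry.

  If \<open>\<phi>\<close> is admissible, polarisation turns the isometry into an identity of inner products, for which the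
  integral over \<open>G\<close> converges absolutely. Its truncations therefore converge to it, which is the Calderon
  condition, with \<open>c = 1 / C\<close>.

  If \<open>\<phi>\<close> is Calderon admissible, the choice \<open>\<psi> = cnj g\<close> and monotone convergence show that the squared norm of
  \<open>V g\<close> is \<open>c\<close> times that of \<open>g\<close> for every Schwartz function \<open>g\<close> (\<open>energy_of_calderon_limit\<close>). Testing on one
  nonzero \<open>g\<close> shows \<open>c > 0\<close>. The equality extends to all of \<open>L\<^sup>2\<close> by Fatou's lemma
  (\<open>energy_extends_to_L2\<close>), because the Schwartz functions are dense (\<open>schwartz_dense_L2\<close>).

  Density needs a supply of Schwartz functions. The functions \<open>exp (- m y\<^bsup>2 m\<^esup>)\<close> of one real variable
  converge to the indicator of \<open>\<bar>y\<bar> < 1\<close> as \<open>m\<close> grows, and have a common Gaussian majorant. Their products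
  approximate boxes, and a Dynkin argument leads from boxes to Borel sets and on to all of \<open>L\<^sup>2\<close>.
\<close>

section \<open>Lebesgue measure on the Heisenberg group\<close>

lemma heis_mult_eq:
  "heis_mult x y = (fst x + fst y, fst (snd x) + fst (snd y),
     snd (snd x) + snd (snd y) + (fst x * fst (snd y) - fst (snd x) * fst y) / 2)"
  by (cases x; cases y) simp

lemma heis_inv_eq: "heis_inv x = (- fst x, - fst (snd x), - snd (snd x))"
  by (cases x) simp

lemma dilation_eq: "dilation a x = (a * fst x, a * fst (snd x), a\<^sup>2 * snd (snd x))"
  by (cases x) simp

lemma borel_measurable_coordinates:
  fixes f :: "'a \<Rightarrow> heis"
  assumes "f \<in> borel_measurable M"
  shows "(\<lambda>x. fst (f x)) \<in> borel_measurable M" "(\<lambda>x. fst (snd (f x))) \<in> borel_measurable M"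
    "(\<lambda>x. snd (snd (f x))) \<in> borel_measurable M"
proof -
  have "(fst :: heis \<Rightarrow> real) \<in> borel_measurable borel"
    "((\<lambda>x. fst (snd x)) :: heis \<Rightarrow> real) \<in> borel_measurable borel"
    "((\<lambda>x. snd (snd x)) :: heis \<Rightarrow> real) \<in> borel_measurable borel"
    by (intro borel_measurable_continuous_onI continuous_intros)+
  then show "(\<lambda>x. fst (f x)) \<in> borel_measurable M" "(\<lambda>x. fst (snd (f x))) \<in> borel_measurable M"
    "(\<lambda>x. snd (snd (f x))) \<in> borel_measurable M"
    using measurable_compose[OF assms] by auto
qed

lemma borel_measurable_heis_mult [measurable]:
  assumes "f \<in> borel_measurable M" "g \<in> borel_measurable M"
  shows "(\<lambda>x. heis_mult (f x) (g x)) \<in> borel_measurable M"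
  using borel_measurable_coordinates[OF assms(1)] borel_measurable_coordinates[OF assms(2)]
  unfolding heis_mult_eq by (intro borel_measurable_Pair borel_measurable_add borel_measurable_diff borel_measurable_times
      borel_measurable_divide borel_measurable_uminus borel_measurable_power borel_measurable_const)

lemma borel_measurable_heis_inv [measurable]:
  assumes "f \<in> borel_measurable M"
  shows "(\<lambda>x. heis_inv (f x)) \<in> borel_measurable M"
  using borel_measurable_coordinates[OF assms(1)]
  unfolding heis_inv_eq by (intro borel_measurable_Pair borel_measurable_add borel_measurable_diff borel_measurable_times
      borel_measurable_divide borel_measurable_uminus borel_measurable_power borel_measurable_const)

lemma borel_measurable_dilation [measurable]:
  assumes "a \<in> borel_measurable M" "f \<in> borel_measurable M"
  shows "(\<lambda>x. dilation (a x) (f x)) \<in> borel_measurable M"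
  using borel_measurable_coordinates[OF assms(2)] assms(1)
  unfolding dilation_eq by (intro borel_measurable_Pair borel_measurable_add borel_measurable_diff borel_measurable_times
      borel_measurable_divide borel_measurable_uminus borel_measurable_power borel_measurable_const)

lemma nn_integral_lborel_prod:
  fixes f :: "'a::euclidean_space \<times> 'b::euclidean_space \<Rightarrow> ennreal"
  assumes [measurable]: "f \<in> borel_measurable borel"
  shows "(\<integral>\<^sup>+x. f x \<partial>lborel) = (\<integral>\<^sup>+x. \<integral>\<^sup>+y. f (x, y) \<partial>lborel \<partial>lborel)"
proof -
  have "f \<in> borel_measurable (lborel \<Otimes>\<^sub>M lborel)"
    by (simp add: lborel_prod)
  from lborel.nn_integral_fst[OF this] show ?thesis
    by (simp add: lborel_prod)
qed

lemma nn_integral_heis: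
  fixes f :: "heis \<Rightarrow> ennreal"
  assumes [measurable]: "f \<in> borel_measurable borel"
  shows "(\<integral>\<^sup>+x. f x \<partial>lborel)
    = (\<integral>\<^sup>+p. \<integral>\<^sup>+q. \<integral>\<^sup>+t. f (p, q, t) \<partial>lborel \<partial>lborel \<partial>lborel)"
proof -
  have 1: "(\<lambda>y. f (p, y)) \<in> borel_measurable borel" for p
    by measurable
  show ?thesis
    by (subst nn_integral_lborel_prod[OF assms], subst nn_integral_lborel_prod[OF 1]) simp
qed

text \<open>Integrating the central coordinate first, the cocycle of the group law is a mere translation
  there; this is why Lebesgue measure is left invariant.\<close>

lemma nn_integral_heis_mult_left:
  assumes [measurable]: "f \<in> borel_measurable borel"
  shows "(\<integral>\<^sup>+x. f (heis_mult v x) \<partial>lborel) = (\<integral>\<^sup>+x. f x \<partial>lborel)"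
proof -
  obtain p0 q0 t0 where v: "v = (p0, q0, t0)" by (cases v)
  have shift: "(\<integral>\<^sup>+x. h (c + x) \<partial>lborel) = (\<integral>\<^sup>+x. h x \<partial>lborel)"
    if "h \<in> borel_measurable borel" for h :: "real \<Rightarrow> ennreal" and c
    using nn_integral_real_affine[OF that, of 1 c] by simp
  have [measurable]: "(\<lambda>(p, q). \<integral>\<^sup>+t. f (p, q, t) \<partial>lborel) \<in> borel_measurable (borel \<Otimes>\<^sub>M borel)"
    by measurable
  have "(\<integral>\<^sup>+x. f (heis_mult v x) \<partial>lborel) =
     (\<integral>\<^sup>+p. \<integral>\<^sup>+q. \<integral>\<^sup>+t. f (p0 + p, q0 + q, (t0 + (p0 * q - q0 * p) / 2) + t) \<partial>lborel \<partial>lborel \<partial>lborel)"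
    by (subst nn_integral_heis) (simp_all add: v algebra_simps)
  also have "\<dots> = (\<integral>\<^sup>+p. \<integral>\<^sup>+q. \<integral>\<^sup>+t. f (p0 + p, q0 + q, t) \<partial>lborel \<partial>lborel \<partial>lborel)"
    by (intro nn_integral_cong shift) simp_all
  also have "\<dots> = (\<integral>\<^sup>+p. \<integral>\<^sup>+q. \<integral>\<^sup>+t. f (p0 + p, q, t) \<partial>lborel \<partial>lborel \<partial>lborel)"
    by (intro nn_integral_cong shift[where h = "\<lambda>q. \<integral>\<^sup>+t. f (p0 + p, q, t) \<partial>lborel" for p]) simp_all
  also have "\<dots> = (\<integral>\<^sup>+p. \<integral>\<^sup>+q. \<integral>\<^sup>+t. f (p, q, t) \<partial>lborel \<partial>lborel \<partial>lborel)"
    by (intro shift[where h = "\<lambda>p. \<integral>\<^sup>+q. \<integral>\<^sup>+t. f (p, q, t) \<partial>lborel \<partial>lborel"]) simp_all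
  also have "\<dots> = (\<integral>\<^sup>+x. f x \<partial>lborel)"
    by (subst nn_integral_heis) simp_all
  finally show ?thesis .
qed

text \<open>The exponent 4 is the homogeneous dimension: the central coordinate scales by \<open>a\<^sup>2\<close>. It is what
  makes \<open>dilate\<close> preserve the \<open>L\<^sup>1\<close> norm.\<close>

lemma nn_integral_dilation:
  assumes [measurable]: "f \<in> borel_measurable borel" and "a > 0"
  shows "(\<integral>\<^sup>+x. f x \<partial>lborel) = ennreal (a ^ 4) * (\<integral>\<^sup>+x. f (dilation a x) \<partial>lborel)"
proof -
  have scale: "(\<integral>\<^sup>+x. h x \<partial>lborel) = ennreal c * (\<integral>\<^sup>+x. h (c * x) \<partial>lborel)"
    if "h \<in> borel_measurable borel" "c > 0" for h :: "real \<Rightarrow> ennreal" and c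
    using nn_integral_real_affine[OF that(1), of c 0] that(2) by simp
  have "(\<integral>\<^sup>+x. f x \<partial>lborel) = (\<integral>\<^sup>+p. \<integral>\<^sup>+q. \<integral>\<^sup>+t. f (p, q, t) \<partial>lborel \<partial>lborel \<partial>lborel)"
    by (rule nn_integral_heis) simp
  also have "\<dots> = (\<integral>\<^sup>+p. \<integral>\<^sup>+q. ennreal (a\<^sup>2) * \<integral>\<^sup>+t. f (p, q, a\<^sup>2 * t) \<partial>lborel \<partial>lborel \<partial>lborel)"
    using \<open>a > 0\<close> by (intro nn_integral_cong scale) simp_all
  also have "\<dots> = (\<integral>\<^sup>+p. ennreal a * \<integral>\<^sup>+q. ennreal (a\<^sup>2) * \<integral>\<^sup>+t. f (p, a * q, a\<^sup>2 * t) \<partial>lborel \<partial>lborel \<partial>lborel)"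
    using \<open>a > 0\<close>
    by (intro nn_integral_cong scale[where c = a and h = "\<lambda>q. ennreal (a\<^sup>2) * \<integral>\<^sup>+t. f (p, q, a\<^sup>2 * t) \<partial>lborel" for p]) simp_all
  also have "\<dots> = ennreal a * (\<integral>\<^sup>+p. ennreal a * \<integral>\<^sup>+q. ennreal (a\<^sup>2) * \<integral>\<^sup>+t. f (a * p, a * q, a\<^sup>2 * t) \<partial>lborel \<partial>lborel \<partial>lborel)"
    using \<open>a > 0\<close>
    by (intro scale[where c = a and h = "\<lambda>p. ennreal a * \<integral>\<^sup>+q. ennreal (a\<^sup>2) * \<integral>\<^sup>+t. f (p, a * q, a\<^sup>2 * t) \<partial>lborel \<partial>lborel"]) simp_all
  also have "\<dots> = ennreal (a ^ 4) * (\<integral>\<^sup>+p. \<integral>\<^sup>+q. \<integral>\<^sup>+t. f (a * p, a * q, a\<^sup>2 * t) \<partial>lborel \<partial>lborel \<partial>lborel)"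
    using \<open>a > 0\<close>
    by (simp add: nn_integral_cmult mult.assoc[symmetric] ennreal_mult[symmetric] power2_eq_square power4_eq_xxxx)
  also have "(\<integral>\<^sup>+p. \<integral>\<^sup>+q. \<integral>\<^sup>+t. f (a * p, a * q, a\<^sup>2 * t) \<partial>lborel \<partial>lborel \<partial>lborel) = (\<integral>\<^sup>+x. f (dilation a x) \<partial>lborel)"
    by (subst nn_integral_heis) simp_all
  finally show ?thesis .
qed

lemma nn_integral_heis_inv:
  assumes [measurable]: "f \<in> borel_measurable borel"
  shows "(\<integral>\<^sup>+x. f (heis_inv x) \<partial>lborel) = (\<integral>\<^sup>+x. f x \<partial>lborel)"
proof -
  have flip: "(\<integral>\<^sup>+x. h (- x) \<partial>lborel) = (\<integral>\<^sup>+x. h x \<partial>lborel)"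
    if "h \<in> borel_measurable borel" for h :: "real \<Rightarrow> ennreal"
    using nn_integral_real_affine[OF that, of "-1" 0] by simp
  have "(\<integral>\<^sup>+x. f (heis_inv x) \<partial>lborel) = (\<integral>\<^sup>+p. \<integral>\<^sup>+q. \<integral>\<^sup>+t. f (- p, - q, - t) \<partial>lborel \<partial>lborel \<partial>lborel)"
    by (subst nn_integral_heis) simp_all
  also have "\<dots> = (\<integral>\<^sup>+p. \<integral>\<^sup>+q. \<integral>\<^sup>+t. f (- p, - q, t) \<partial>lborel \<partial>lborel \<partial>lborel)"
    by (intro nn_integral_cong flip) simp_all
  also have "\<dots> = (\<integral>\<^sup>+p. \<integral>\<^sup>+q. \<integral>\<^sup>+t. f (- p, q, t) \<partial>lborel \<partial>lborel \<partial>lborel)"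
    by (intro nn_integral_cong flip[where h = "\<lambda>q. \<integral>\<^sup>+t. f (- p, q, t) \<partial>lborel" for p]) simp_all
  also have "\<dots> = (\<integral>\<^sup>+p. \<integral>\<^sup>+q. \<integral>\<^sup>+t. f (p, q, t) \<partial>lborel \<partial>lborel \<partial>lborel)"
    by (intro flip[where h = "\<lambda>p. \<integral>\<^sup>+q. \<integral>\<^sup>+t. f (p, q, t) \<partial>lborel \<partial>lborel"]) simp_all
  also have "\<dots> = (\<integral>\<^sup>+x. f x \<partial>lborel)"
    by (subst nn_integral_heis) simp_all
  finally show ?thesis .
qed

lemma heis_mult_inv_eq: "heis_mult (heis_inv x) v = heis_inv (heis_mult (heis_inv v) x)"
  by (cases x; cases v) (simp add: field_simps)

text \<open>Since \<open>\<omega>\<inverse>v = (v\<inverse>\<omega>)\<inverse>\<close>, inversion and left translation suffice.\<close>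

lemma nn_integral_heis_mult_inv:
  assumes [measurable]: "f \<in> borel_measurable borel"
  shows "(\<integral>\<^sup>+x. f (heis_mult (heis_inv x) v) \<partial>lborel) = (\<integral>\<^sup>+x. f x \<partial>lborel)"
proof -
  have "(\<integral>\<^sup>+x. f (heis_mult (heis_inv x) v) \<partial>lborel)
      = (\<integral>\<^sup>+x. f (heis_inv (heis_mult (heis_inv v) x)) \<partial>lborel)"
    by (subst heis_mult_inv_eq) (rule refl)
  also have "\<dots> = (\<integral>\<^sup>+x. f (heis_inv x) \<partial>lborel)"
    by (rule nn_integral_heis_mult_left) measurable
  finally show ?thesis
    by (simp add: nn_integral_heis_inv)
qed

lemma lebesgue_integral_heis_mult_left:
  fixes f :: "heis \<Rightarrow> complex"
  assumes [measurable]: "f \<in> borel_measurable borel"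
  shows "(LINT x|lborel. f (heis_mult v x)) = (LINT x|lborel. f x)"
proof -
  have [measurable]: "heis_mult v \<in> lborel \<rightarrow>\<^sub>M borel"
    by measurable
  have "distr lborel borel (heis_mult v) = lborel"
  proof (rule measure_eqI)
    fix A assume "A \<in> sets (distr lborel borel (heis_mult v))"
    then have A [measurable]: "A \<in> sets borel" by simp
    have "emeasure (distr lborel borel (heis_mult v)) A = (\<integral>\<^sup>+x. indicator A x \<partial>distr lborel borel (heis_mult v))"
      by simp
    also have "\<dots> = (\<integral>\<^sup>+x. indicator A (heis_mult v x) \<partial>lborel)"
      by (rule nn_integral_distr) measurable
    also have "\<dots> = (\<integral>\<^sup>+x. indicator A x \<partial>lborel)"
      by (rule nn_integral_heis_mult_left) measurable
    finally show "emeasure (distr lborel borel (heis_mult v)) A = emeasure lborel A"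
      by simp
  qed simp
  then show ?thesis
    using integral_distr[of "heis_mult v" lborel borel f] by simp
qed

lemma borel_measurable_dilate [measurable]:
  assumes [measurable]: "\<phi> \<in> borel_measurable borel" "a \<in> borel_measurable M" "f \<in> borel_measurable M"
  shows "(\<lambda>x. dilate (a x) \<phi> (f x)) \<in> borel_measurable M"
  unfolding dilate_def by measurable

lemma nn_integral_dilate:
  assumes [measurable]: "\<phi> \<in> borel_measurable borel" and "a > 0"
  shows "(\<integral>\<^sup>+x. norm (dilate a \<phi> x) \<partial>lborel) = (\<integral>\<^sup>+x. norm (\<phi> x) \<partial>lborel)"
proof -
  have "(\<integral>\<^sup>+x. norm (\<phi> x) \<partial>lborel) = ennreal ((1 / a) ^ 4) * (\<integral>\<^sup>+x. norm (\<phi> (dilation (1 / a) x)) \<partial>lborel)"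
    using \<open>a > 0\<close> by (intro nn_integral_dilation) auto
  also have "\<dots> = (\<integral>\<^sup>+x. norm (dilate a \<phi> x) \<partial>lborel)"
    using \<open>a > 0\<close>
    by (subst nn_integral_cmult[symmetric]) (auto simp: dilate_def ennreal_mult[symmetric] power_one_over field_simps)
  finally show ?thesis ..
qed

section \<open>Integrals over product spaces\<close>

lemma lebesgue_integral_lborel_prod:
  fixes f :: "'a::euclidean_space \<times> 'b::euclidean_space \<Rightarrow> 'c::{banach, second_countable_topology}"
  assumes "integrable lborel f"
  shows "(LINT z|lborel. f z) = (LINT x|lborel. LINT y|lborel. f (x, y))"
    and "(LINT z|lborel. f z) = (LINT y|lborel. LINT x|lborel. f (x, y))"
    and "integrable lborel (\<lambda>x. LINT y|lborel. f (x, y))"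
    and "integrable lborel (\<lambda>y. LINT x|lborel. f (x, y))"
proof -
  have f: "integrable (lborel \<Otimes>\<^sub>M lborel) (\<lambda>(x, y). f (x, y))"
    using assms by (simp add: lborel_prod)
  show "(LINT z|lborel. f z) = (LINT x|lborel. LINT y|lborel. f (x, y))"
    using lborel_pair.integral_fst'[of "\<lambda>z. f z"] f by (simp add: lborel_prod)
  show "(LINT z|lborel. f z) = (LINT y|lborel. LINT x|lborel. f (x, y))"
    using lborel_pair.integral_snd[OF f] by (simp add: lborel_prod)
  show "integrable lborel (\<lambda>x. LINT y|lborel. f (x, y))"
    using lborel_pair.integrable_fst[OF f] by simp
  show "integrable lborel (\<lambda>y. LINT x|lborel. f (x, y))"
    using lborel_pair.integrable_snd[OF f] by simp
qed

lemma integrable_lborel_product: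
  fixes u :: "'a::euclidean_space \<Rightarrow> complex" and v :: "'b::euclidean_space \<Rightarrow> complex"
  assumes u: "integrable lborel u" and v: "integrable lborel v"
  shows "integrable lborel (\<lambda>z. u (fst z) * v (snd z))"
    and "(LINT z|lborel. u (fst z) * v (snd z)) = (LINT x|lborel. u x) * (LINT y|lborel. v y)"
proof -
  have [measurable]: "u \<in> borel_measurable borel" "v \<in> borel_measurable borel"
    using borel_measurable_integrable[OF u] borel_measurable_integrable[OF v] by simp_all
  have m [measurable]: "(\<lambda>z. u (fst z) * v (snd z)) \<in> borel_measurable borel"
    unfolding borel_prod[symmetric] by measurable
  show i: "integrable lborel (\<lambda>z. u (fst z) * v (snd z))"
  proof (rule integrableI_bounded)
    have "(\<integral>\<^sup>+z. norm (u (fst z) * v (snd z)) \<partial>lborel)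
        = (\<integral>\<^sup>+x. \<integral>\<^sup>+y. norm (u x) * norm (v y) \<partial>lborel \<partial>lborel)"
      by (subst nn_integral_lborel_prod[OF measurable_compose[OF m]]) (simp_all add: norm_mult)
    also have "\<dots> = (\<integral>\<^sup>+x. norm (u x) \<partial>lborel) * (\<integral>\<^sup>+y. norm (v y) \<partial>lborel)"
      by (simp add: ennreal_mult nn_integral_cmult nn_integral_multc)
    also have "\<dots> < \<infinity>"
      using u v by (simp add: integrable_iff_bounded ennreal_mult_less_top)
    finally show "(\<integral>\<^sup>+z. norm (u (fst z) * v (snd z)) \<partial>lborel) < \<infinity>" .
  qed simp
  show "(LINT z|lborel. u (fst z) * v (snd z)) = (LINT x|lborel. u x) * (LINT y|lborel. v y)"
    by (subst lebesgue_integral_lborel_prod(1)[OF i]) simp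
qed

lemma borel_measurable_cnj [measurable]:
  assumes "f \<in> borel_measurable M"
  shows "(\<lambda>x. cnj (f x)) \<in> borel_measurable M"
  using assms by (rule measurable_compose) (intro borel_measurable_continuous_onI continuous_intros)

lemma integrable_mult_bounded:
  fixes g h :: "'a \<Rightarrow> complex"
  assumes g: "integrable N g" and [measurable]: "h \<in> borel_measurable N" and B: "\<And>x. norm (h x) \<le> B"
  shows "integrable N (\<lambda>x. g x * h x)"
proof (rule Bochner_Integration.integrable_bound)
  show "integrable N (\<lambda>x. B *\<^sub>R g x)"
    using g by (rule integrable_scaleR_right)
  show "(\<lambda>x. g x * h x) \<in> borel_measurable N"
    using borel_measurable_integrable[OF g] by measurable
  have "0 \<le> B" using order_trans[OF norm_ge_zero B] .
  then show "AE x in N. norm (g x * h x) \<le> norm (B *\<^sub>R g x)"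
    using mult_right_mono[OF B norm_ge_zero] by (intro AE_I2) (simp add: norm_mult mult.commute)
qed

section \<open>The wavelet transform and the Calderon kernel\<close>

lemma quasi_regular_eq:
  "quasi_regular x f v = (1 / (snd x)\<^sup>2) *\<^sub>R f (dilation (1 / snd x) (heis_mult (heis_inv (fst x)) v))"
  by (cases x) simp

lemma borel_measurable_wavelet_transform [measurable]:
  assumes [measurable]: "\<phi> \<in> borel_measurable borel" "f \<in> borel_measurable borel"
  shows "wavelet_transform \<phi> f \<in> borel_measurable borel"
proof -
  have "wavelet_transform \<phi> f \<in> borel_measurable (borel \<Otimes>\<^sub>M borel)"
    unfolding wavelet_transform_def[abs_def] L2_inner_def quasi_regular_eq by measurable
  then show ?thesis
    by (simp add: borel_prod)
qed

text \<open>The integral is the value at \<open>\<omega>\<close> of the convolution of \<open>f\<close> with \<open>tilde (dilate a \<phi>)\<close>: the factor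
  \<open>a\<^sup>2\<close> passes from the \<open>L\<^sup>2\<close> to the \<open>L\<^sup>1\<close> normalisation of the dilates.\<close>

lemma wavelet_transform_dilate:
  assumes "a > 0"
  shows "wavelet_transform \<phi> f (\<omega>, a)
    = a\<^sup>2 *\<^sub>R (LINT v|lborel. f v * cnj (dilate a \<phi> (heis_mult (heis_inv \<omega>) v)))"
proof -
  have "wavelet_transform \<phi> f (\<omega>, a)
     = (LINT v|lborel. a\<^sup>2 *\<^sub>R (f v * cnj (dilate a \<phi> (heis_mult (heis_inv \<omega>) v))))"
    unfolding wavelet_transform_def L2_inner_def dilate_def quasi_regular.simps
    using assms by (intro Bochner_Integration.integral_cong)
      (auto simp: scaleR_conv_of_real field_simps power2_eq_square power4_eq_xxxx)
  then show ?thesis by simp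
qed

text \<open>The Haar density, extended by 0 to \<open>a \<le> 0\<close>, so that integrals over \<open>G\<close> become Lebesgue
  integrals over a full product space, where Fubini's theorem applies.\<close>

definition haar_weight :: "heis \<times> real \<Rightarrow> real" where
  "haar_weight x = indicator {0<..} (snd x) / snd x ^ 5"

lemma haar_weight_nonneg [simp]: "0 \<le> haar_weight x"
  by (auto simp: haar_weight_def split: split_indicator)

lemma borel_measurable_haar_weight [measurable]: "haar_weight \<in> borel_measurable borel"
proof -
  have "haar_weight \<in> borel_measurable (borel \<Otimes>\<^sub>M borel)"
    unfolding haar_weight_def[abs_def] by measurable
  then show ?thesis by (simp add: borel_prod)
qed

lemma half_space_borel [measurable]: "(UNIV :: heis set) \<times> {0<..} \<in> sets (borel :: (heis \<times> real) measure)"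
  by (intro borel_open open_Times) auto

lemma measurable_haar_G:
  assumes "f \<in> borel_measurable borel"
  shows "f \<in> borel_measurable haar_G"
  unfolding haar_G_def using assms by (auto intro: measurable_restrict_space1)

lemma haar_G_alt:
  "haar_G = density (restrict_space lborel (UNIV \<times> {0<..})) (\<lambda>x. ennreal (1 / snd x ^ 5))"
  unfolding haar_G_def by (simp add: case_prod_beta')

lemma haar_density_measurable:
  "(\<lambda>x :: heis \<times> real. 1 / snd x ^ 5) \<in> borel_measurable (restrict_space lborel (UNIV \<times> {0<..}))"
proof -
  have "(\<lambda>x :: heis \<times> real. 1 / snd x ^ 5) \<in> borel_measurable (borel \<Otimes>\<^sub>M borel)"
    by measurable
  then show ?thesis
    by (intro measurable_restrict_space1) (simp add: borel_prod)
qed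

lemma nn_integral_haar_G:
  assumes [measurable]: "f \<in> borel_measurable borel"
  shows "(\<integral>\<^sup>+x. f x \<partial>haar_G) = (\<integral>\<^sup>+x. ennreal (haar_weight x) * f x \<partial>lborel)"
proof -
  have "(\<integral>\<^sup>+x. f x \<partial>haar_G)
      = (\<integral>\<^sup>+x. ennreal (1 / snd x ^ 5) * f x \<partial>restrict_space lborel (UNIV \<times> {0<..}))"
    unfolding haar_G_alt
    by (intro nn_integral_density measurable_restrict_space1 measurable_compose[OF haar_density_measurable]) auto
  also have "\<dots> = (\<integral>\<^sup>+x. ennreal (1 / snd x ^ 5) * f x * indicator (UNIV \<times> {0<..}) x \<partial>lborel)"
    by (rule nn_integral_restrict_space) auto
  also have "\<dots> = (\<integral>\<^sup>+x. ennreal (haar_weight x) * f x \<partial>lborel)"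
    by (intro nn_integral_cong) (auto simp: haar_weight_def mem_Times_iff split: split_indicator)
  finally show ?thesis .
qed

lemma
  fixes f :: "heis \<times> real \<Rightarrow> 'b::{banach, second_countable_topology}"
  assumes [measurable]: "f \<in> borel_measurable borel"
  shows integrable_haar_G: "integrable haar_G f \<longleftrightarrow> integrable lborel (\<lambda>x. haar_weight x *\<^sub>R f x)"
    and integral_haar_G: "(LINT x|haar_G. f x) = (LINT x|lborel. haar_weight x *\<^sub>R f x)"
proof -
  have f: "f \<in> borel_measurable (restrict_space lborel (UNIV \<times> {0<..}))"
    by (intro measurable_restrict_space1) simp
  have pos: "AE x in restrict_space lborel (UNIV \<times> {0<..}). 0 \<le> 1 / snd (x :: heis \<times> real) ^ 5"
    by (intro AE_I2) (auto simp: space_restrict_space)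
  have *: "indicator (UNIV \<times> {0<..}) x / snd x ^ 5 = haar_weight x" for x
    by (auto simp: haar_weight_def mem_Times_iff split: split_indicator)
  show "integrable haar_G f \<longleftrightarrow> integrable lborel (\<lambda>x. haar_weight x *\<^sub>R f x)"
    unfolding haar_G_alt
    by (subst integrable_density[OF f haar_density_measurable pos], subst integrable_restrict_space)
      (auto simp: *)
  show "(LINT x|haar_G. f x) = (LINT x|lborel. haar_weight x *\<^sub>R f x)"
    unfolding haar_G_alt
    by (subst integral_density[OF f haar_density_measurable pos], subst integral_restrict_space)
      (auto simp: *)
qed

locale integrable_wavelet =
  fixes \<phi> :: "heis \<Rightarrow> complex" and M :: real
  assumes integrable_wavelet: "integrable lborel \<phi>"
    and wavelet_bounded: "\<And>x. norm (\<phi> x) \<le> M"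
begin

lemma wavelet_measurable [measurable]: "\<phi> \<in> borel_measurable borel"
  using borel_measurable_integrable[OF integrable_wavelet] by simp

lemma dilate_bounded: "norm (dilate a \<phi> x) \<le> M / a ^ 4"
  using wavelet_bounded[of "dilation (1 / a) x"]
  by (auto simp: dilate_def divide_simps mult.commute)

lemma M_nonneg: "0 \<le> M"
  using order_trans[OF norm_ge_zero wavelet_bounded] .

text \<open>The integrand of the autocorrelation of the dilates, cut off to \<open>\<epsilon> \<le> a \<le> A\<close>. It is written
  with the two points \<open>v\<close>, \<open>x\<close> of the group rather than with \<open>v\<inverse>x\<close>, on which its
  integral depends.\<close>

definition correlation :: "real \<Rightarrow> real \<Rightarrow> heis \<Rightarrow> heis \<Rightarrow> heis \<times> real \<Rightarrow> complex" where
  "correlation \<epsilon> A v x y = (indicator {\<epsilon>..A} (snd y) / snd y) *\<^sub>R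
     (cnj (dilate (snd y) \<phi> (heis_mult (heis_inv (fst y)) v)) *
      dilate (snd y) \<phi> (heis_mult (heis_inv (fst y)) x))"

lemma correlation_measurable [measurable]:
  assumes [measurable]: "v \<in> borel_measurable N" "x \<in> borel_measurable N" "y \<in> N \<rightarrow>\<^sub>M borel \<Otimes>\<^sub>M borel"
  shows "(\<lambda>z. correlation \<epsilon> A (v z) (x z) (y z)) \<in> borel_measurable N"
  unfolding correlation_def by measurable

text \<open>One of the two factors is bounded by its supremum, at most \<open>M / \<epsilon>\<^sup>4\<close>, and the other one has the
  \<open>L\<^sup>1\<close> norm of \<open>\<phi>\<close> for every \<open>a\<close>. The uniformity in the two points is what lets the bound be
  integrated against \<open>g v * \<psi> x\<close>.\<close>

lemma nn_integral_correlation_bound: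
  assumes "0 < \<epsilon>"
  obtains K where "K < \<infinity>" "\<And>v x. (\<integral>\<^sup>+y. norm (correlation \<epsilon> A v x y) \<partial>lborel) \<le> K"
proof
  let ?N = "\<integral>\<^sup>+x. norm (\<phi> x) \<partial>lborel"
  let ?K = "(ennreal (M / \<epsilon> ^ 5) * ?N) * emeasure lborel {\<epsilon>..A}"
  show "?K < \<infinity>"
    using integrable_wavelet by (auto simp: integrable_iff_bounded ennreal_mult_less_top emeasure_lborel_Icc_eq)
  fix v x
  have cm: "(\<lambda>y. correlation \<epsilon> A v x y) \<in> borel_measurable (borel \<Otimes>\<^sub>M borel)"
    by measurable
  then have [measurable]: "(\<lambda>y. correlation \<epsilon> A v x y) \<in> borel_measurable borel"
    by (simp add: borel_prod)
  have "(\<integral>\<^sup>+y. norm (correlation \<epsilon> A v x y) \<partial>lborel)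
      = (\<integral>\<^sup>+\<omega>. \<integral>\<^sup>+a. norm (correlation \<epsilon> A v x (\<omega>, a)) \<partial>lborel \<partial>lborel)"
    by (rule nn_integral_lborel_prod) measurable
  also have "\<dots> = (\<integral>\<^sup>+a. \<integral>\<^sup>+\<omega>. norm (correlation \<epsilon> A v x (\<omega>, a)) \<partial>lborel \<partial>lborel)"
    by (rule lborel_pair.Fubini') measurable
  also have "\<dots> \<le> (\<integral>\<^sup>+a. (ennreal (M / \<epsilon> ^ 5) * ?N) * indicator {\<epsilon>..A} a \<partial>lborel)"
  proof (rule nn_integral_mono)
    fix a :: real
    show "(\<integral>\<^sup>+\<omega>. norm (correlation \<epsilon> A v x (\<omega>, a)) \<partial>lborel) \<le> (ennreal (M / \<epsilon> ^ 5) * ?N) * indicator {\<epsilon>..A} a"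
    proof (cases "a \<in> {\<epsilon>..A}")
      case True
      then have a: "\<epsilon> \<le> a" "0 < a" using assms by auto
      have "norm (correlation \<epsilon> A v x (\<omega>, a)) \<le> (M / \<epsilon> ^ 5) * norm (dilate a \<phi> (heis_mult (heis_inv \<omega>) v))" for \<omega>
      proof -
        have "(1 / a) * norm (dilate a \<phi> (heis_mult (heis_inv \<omega>) x)) \<le> (1 / a) * (M / a ^ 4)"
          using dilate_bounded a by (intro mult_left_mono) auto
        also have "\<dots> = M / a ^ 5"
          by (simp add: power_Suc[symmetric] eval_nat_numeral)
        also have "\<dots> \<le> M / \<epsilon> ^ 5"
          using M_nonneg a assms by (intro divide_left_mono power_mono mult_pos_pos) auto
        finally have "(1 / a) * norm (dilate a \<phi> (heis_mult (heis_inv \<omega>) x)) * norm (dilate a \<phi> (heis_mult (heis_inv \<omega>) v))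
          \<le> M / \<epsilon> ^ 5 * norm (dilate a \<phi> (heis_mult (heis_inv \<omega>) v))"
          by (rule mult_right_mono) simp
        then show ?thesis
          using True a by (simp add: correlation_def norm_mult mult.commute)
      qed
      then have "(\<integral>\<^sup>+\<omega>. norm (correlation \<epsilon> A v x (\<omega>, a)) \<partial>lborel)
          \<le> (\<integral>\<^sup>+\<omega>. ennreal (M / \<epsilon> ^ 5) * norm (dilate a \<phi> (heis_mult (heis_inv \<omega>) v)) \<partial>lborel)"
        using M_nonneg assms by (intro nn_integral_mono) (simp add: ennreal_mult[symmetric])
      also have "\<dots> = ennreal (M / \<epsilon> ^ 5) * (\<integral>\<^sup>+\<omega>. norm (dilate a \<phi> (heis_mult (heis_inv \<omega>) v)) \<partial>lborel)"
        by (rule nn_integral_cmult) measurable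
      also have "(\<integral>\<^sup>+\<omega>. norm (dilate a \<phi> (heis_mult (heis_inv \<omega>) v)) \<partial>lborel) = (\<integral>\<^sup>+\<omega>. norm (dilate a \<phi> \<omega>) \<partial>lborel)"
        by (rule nn_integral_heis_mult_inv[where f = "\<lambda>z. ennreal (norm (dilate a \<phi> z))"]) measurable
      also have "\<dots> = ?N"
        using a by (intro nn_integral_dilate) auto
      finally show ?thesis using True by simp
    qed (simp add: correlation_def)
  qed
  also have "\<dots> = ?K"
    by (subst nn_integral_cmult) auto
  finally show "(\<integral>\<^sup>+y. norm (correlation \<epsilon> A v x y) \<partial>lborel) \<le> ?K" .
qed

lemma integrable_correlation:
  assumes "0 < \<epsilon>"
  shows "integrable lborel (correlation \<epsilon> A v x)"
proof (rule integrableI_bounded)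
  have "(\<lambda>y. correlation \<epsilon> A v x y) \<in> borel_measurable (borel \<Otimes>\<^sub>M borel)"
    by measurable
  then show "correlation \<epsilon> A v x \<in> borel_measurable lborel"
    by (simp add: borel_prod)
  show "(\<integral>\<^sup>+y. norm (correlation \<epsilon> A v x y) \<partial>lborel) < \<infinity>"
    using nn_integral_correlation_bound[OF assms] by (metis order_le_less_trans)
qed

text \<open>The substitution \<open>w = v\<inverse>\<omega>\<close> in the convolution integral turns the kernel into an
  autocorrelation: \<open>w\<inverse> = \<omega>\<inverse>v\<close> and \<open>w\<inverse>v\<inverse>x = \<omega>\<inverse>x\<close>.\<close>

lemma integral_correlation:
  assumes "0 < \<epsilon>"
  shows "(LINT y|lborel. correlation \<epsilon> A v x y) = calderon_kernel \<phi> \<epsilon> A (heis_mult (heis_inv v) x)"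
proof -
  have "(LINT y|lborel. correlation \<epsilon> A v x y) = (LINT a|lborel. LINT \<omega>|lborel. correlation \<epsilon> A v x (\<omega>, a))"
    by (rule lebesgue_integral_lborel_prod(2)) (rule integrable_correlation[OF assms])
  also have "\<dots> = calderon_kernel \<phi> \<epsilon> A (heis_mult (heis_inv v) x)"
    unfolding calderon_kernel_def set_lebesgue_integral_def
  proof (rule Bochner_Integration.integral_cong[OF refl])
    fix a :: real
    let ?h = "\<lambda>w. tilde (dilate a \<phi>) w * dilate a \<phi> (heis_mult (heis_inv w) (heis_mult (heis_inv v) x))"
    have 1: "heis_inv (heis_mult (heis_inv v) \<omega>) = heis_mult (heis_inv \<omega>) v" for \<omega>
      by (cases \<omega>; cases v) (simp add: field_simps)
    have 2: "heis_mult (heis_mult (heis_inv \<omega>) v) (heis_mult (heis_inv v) x) = heis_mult (heis_inv \<omega>) x" for \<omega>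
      by (metis heis_group(1,2,5))
    have "heis_conv (tilde (dilate a \<phi>)) (dilate a \<phi>) (heis_mult (heis_inv v) x) = (LINT w|lborel. ?h w)"
      by (simp add: heis_conv_def)
    also have "\<dots> = (LINT w|lborel. ?h (heis_mult (heis_inv v) w))"
      by (rule lebesgue_integral_heis_mult_left[symmetric]) (unfold tilde_def, measurable)
    also have "\<dots> = (LINT \<omega>|lborel. cnj (dilate a \<phi> (heis_mult (heis_inv \<omega>) v)) * dilate a \<phi> (heis_mult (heis_inv \<omega>) x))"
      by (simp only: tilde_def 1 2)
    finally show "(LINT \<omega>|lborel. correlation \<epsilon> A v x (\<omega>, a)) =
      indicat_real {\<epsilon>..A} a *\<^sub>R (1 / a) *\<^sub>R
        heis_conv (tilde (dilate a \<phi>)) (dilate a \<phi>) (heis_mult (heis_inv v) x)"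
      by (simp add: correlation_def)
  qed
  finally show ?thesis .
qed

text \<open>Both sides are iterated integrals of one function of \<open>v\<close>, \<open>x\<close>, \<open>\<omega>\<close>, \<open>a\<close>, which is absolutely
  integrable by the uniform bound above: integrating first over \<open>(\<omega>, a)\<close> produces the kernel,
  integrating first over \<open>(v, x)\<close> factors into two wavelet transforms.\<close>

lemma
  fixes A :: real
  assumes \<epsilon>: "0 < \<epsilon>" and g: "integrable lborel g" and \<psi>: "integrable lborel \<psi>"
  defines "R \<equiv> \<lambda>y. (indicator {\<epsilon>..A} (snd y) * haar_weight y) *\<^sub>R
      (wavelet_transform \<phi> g y * cnj (wavelet_transform \<phi> (\<lambda>x. cnj (\<psi> x)) y))"
  shows integrable_truncated_wavelet_product: "integrable lborel R"
    and calderon_kernel_pairing: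
      "(LINT x|lborel. heis_conv g (calderon_kernel \<phi> \<epsilon> A) x * \<psi> x) = (LINT y|lborel. R y)"
proof -
  have [measurable]: "g \<in> borel_measurable borel" "\<psi> \<in> borel_measurable borel"
    using borel_measurable_integrable[OF g] borel_measurable_integrable[OF \<psi>] by simp_all
  let ?F = "\<lambda>z :: (heis \<times> heis) \<times> (heis \<times> real).
    (g (fst (fst z)) * \<psi> (snd (fst z))) * correlation \<epsilon> A (fst (fst z)) (snd (fst z)) (snd z)"
  have "?F \<in> borel_measurable ((borel \<Otimes>\<^sub>M borel) \<Otimes>\<^sub>M (borel \<Otimes>\<^sub>M borel))"
    by measurable
  then have Fm [measurable]: "?F \<in> borel_measurable borel"
    by (simp add: borel_prod)
  obtain K where K: "K < \<infinity>" "\<And>v x. (\<integral>\<^sup>+y. norm (correlation \<epsilon> A v x y) \<partial>lborel) \<le> K"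
    using nn_integral_correlation_bound[OF \<epsilon>] by blast
  have F: "integrable lborel ?F"
  proof (rule integrableI_bounded)
    have [measurable]: "correlation \<epsilon> A v x \<in> borel_measurable borel" for v x
      using borel_measurable_integrable[OF integrable_correlation[OF \<epsilon>, of A v x]] by simp
    have gp: "integrable lborel (\<lambda>p. g (fst p) * \<psi> (snd p))"
      by (rule integrable_lborel_product[OF g \<psi>])
    then have [measurable]: "(\<lambda>p. g (fst p) * \<psi> (snd p)) \<in> borel_measurable borel"
      using borel_measurable_integrable by simp
    have "(\<integral>\<^sup>+z. norm (?F z) \<partial>lborel) =
      (\<integral>\<^sup>+p. \<integral>\<^sup>+y. norm (?F (p, y)) \<partial>lborel \<partial>lborel)"
      by (rule nn_integral_lborel_prod) measurable
    also have "\<dots> = (\<integral>\<^sup>+p. norm (g (fst p) * \<psi> (snd p)) *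
        (\<integral>\<^sup>+y. norm (correlation \<epsilon> A (fst p) (snd p) y) \<partial>lborel) \<partial>lborel)"
      by (intro nn_integral_cong) (subst nn_integral_cmult[symmetric], simp_all add: norm_mult ennreal_mult)
    also have "\<dots> \<le> (\<integral>\<^sup>+p. norm (g (fst p) * \<psi> (snd p)) * K \<partial>lborel)"
      by (intro nn_integral_mono mult_left_mono K) simp
    also have "\<dots> = (\<integral>\<^sup>+p. norm (g (fst p) * \<psi> (snd p)) \<partial>lborel) * K"
      by (rule nn_integral_multc) simp
    also have "\<dots> < \<infinity>"
      using gp K(1) by (simp add: integrable_iff_bounded ennreal_mult_less_top)
    finally show "(\<integral>\<^sup>+z. norm (?F z) \<partial>lborel) < \<infinity>" .
  qed simp
  have inner: "(LINT p|lborel. ?F (p, y)) = R y" for y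
  proof (cases "snd y \<in> {\<epsilon>..A}")
    case True
    obtain \<omega> a where y: "y = (\<omega>, a)" by (cases y)
    have a: "0 < a" using True \<epsilon> y by auto
    let ?u = "\<lambda>v. g v * cnj (dilate a \<phi> (heis_mult (heis_inv \<omega>) v))"
    let ?w = "\<lambda>x. \<psi> x * dilate a \<phi> (heis_mult (heis_inv \<omega>) x)"
    have u: "integrable lborel ?u"
      by (rule integrable_mult_bounded[OF g, where B = "M / a ^ 4"]) (use dilate_bounded in auto)
    have w: "integrable lborel ?w"
      by (rule integrable_mult_bounded[OF \<psi>, where B = "M / a ^ 4"]) (use dilate_bounded in auto)
    have "(LINT p|lborel. ?F (p, y)) = (LINT p|lborel. (1 / a) *\<^sub>R (?u (fst p) * ?w (snd p)))"
      using True y by (intro Bochner_Integration.integral_cong refl)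
        (simp add: correlation_def scaleR_conv_of_real)
    also have "\<dots> = (1 / a) *\<^sub>R ((LINT v|lborel. ?u v) * (LINT x|lborel. ?w x))"
      by (simp add: integrable_lborel_product(2)[OF u w])
    also have "\<dots> = R y"
    proof -
      have "cnj (wavelet_transform \<phi> (\<lambda>x. cnj (\<psi> x)) y) = a\<^sup>2 *\<^sub>R (LINT x|lborel. ?w x)"
        unfolding y wavelet_transform_dilate[OF a]
        using Bochner_Integration.integral_cnj[of lborel ?w] by simp
      moreover have "wavelet_transform \<phi> g y = a\<^sup>2 *\<^sub>R (LINT v|lborel. ?u v)"
        unfolding y wavelet_transform_dilate[OF a] ..
      \<comment> \<open>The factors \<open>a\<^sup>2\<close> of the two transforms turn the measure \<open>da / a\<close> into the Haar density.\<close>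
      moreover have "1 / a = (a\<^sup>2 * a\<^sup>2) / a ^ 5"
        using a by (simp add: field_simps eval_nat_numeral)
      ultimately show ?thesis
        using True a by (simp add: R_def y haar_weight_def scaleR_conv_of_real)
    qed
    finally show ?thesis .
  qed (simp add: R_def correlation_def)
  show "integrable lborel R"
    using lebesgue_integral_lborel_prod(4)[OF F] unfolding inner .
  have kernel: "(LINT y|lborel. ?F (p, y)) =
      g (fst p) * calderon_kernel \<phi> \<epsilon> A (heis_mult (heis_inv (fst p)) (snd p)) * \<psi> (snd p)" for p
    by (simp add: integral_correlation[OF \<epsilon>])
  have "(LINT y|lborel. R y) = (LINT y|lborel. LINT p|lborel. ?F (p, y))"
    unfolding inner ..
  also have "\<dots> = (LINT z|lborel. ?F z)"
    by (rule lebesgue_integral_lborel_prod(2)[OF F, symmetric])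
  also have "\<dots> = (LINT p|lborel. LINT y|lborel. ?F (p, y))"
    by (rule lebesgue_integral_lborel_prod(1)[OF F])
  also have "\<dots> = (LINT p|lborel. g (fst p) * calderon_kernel \<phi> \<epsilon> A (heis_mult (heis_inv (fst p)) (snd p)) * \<psi> (snd p))"
    unfolding kernel ..
  also have "\<dots> = (LINT x|lborel. LINT v|lborel. g v * calderon_kernel \<phi> \<epsilon> A (heis_mult (heis_inv v) x) * \<psi> x)"
    using lebesgue_integral_lborel_prod(3)[OF F] unfolding kernel
    by (subst lebesgue_integral_lborel_prod(2)) auto
  also have "\<dots> = (LINT x|lborel. heis_conv g (calderon_kernel \<phi> \<epsilon> A) x * \<psi> x)"
    unfolding heis_conv_def by simp
  finally show "(LINT x|lborel. heis_conv g (calderon_kernel \<phi> \<epsilon> A) x * \<psi> x) = (LINT y|lborel. R y)" ..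
qed

end

section \<open>Schwartz functions\<close>

lemma partial_deriv_eq:
  assumes "\<And>x. (f has_derivative f' x) (at x)"
  shows "partial_deriv b f = (\<lambda>x. f' x b)"
  unfolding partial_deriv_def using frechet_derivative_at[OF assms] by metis

lemma schwartz_has_derivative:
  assumes "f \<in> schwartz" "bs \<in> lists Basis"
  shows "(foldr partial_deriv bs f has_derivative frechet_derivative (foldr partial_deriv bs f) (at x)) (at x)"
  using assms by (auto simp: schwartz_def frechet_derivative_works[symmetric])

lemma schwartz_bounded_deriv:
  assumes "f \<in> schwartz" "bs \<in> lists Basis"
  shows "bounded (range (\<lambda>x. norm x ^ k *\<^sub>R foldr partial_deriv bs f x))"
  using assms by (auto simp: schwartz_def)

lemma schwartzI:
  assumes "\<And>bs. bs \<in> lists Basis \<Longrightarrow> foldr partial_deriv bs f = d bs"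
    and "\<And>bs x. bs \<in> lists Basis \<Longrightarrow> d bs differentiable (at x)"
    and "\<And>bs k. bs \<in> lists Basis \<Longrightarrow> bounded (range (\<lambda>x. norm x ^ k *\<^sub>R d bs x))"
  shows "f \<in> schwartz"
  using assms unfolding schwartz_def by auto

lemma schwartz_linear_image:
  assumes f: "f \<in> schwartz" and T: "bounded_linear T"
  shows "(\<lambda>x. T (f x)) \<in> schwartz"
proof (rule schwartzI[where d = "\<lambda>bs x. T (foldr partial_deriv bs f x)"])
  have deriv: "((\<lambda>x. T (foldr partial_deriv bs f x)) has_derivative
      (\<lambda>h. T (frechet_derivative (foldr partial_deriv bs f) (at x) h))) (at x)"
    if "bs \<in> lists Basis" for bs x
    by (rule bounded_linear.has_derivative[OF T schwartz_has_derivative[OF f that]])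
  show "foldr partial_deriv bs (\<lambda>x. T (f x)) = (\<lambda>x. T (foldr partial_deriv bs f x))"
    if "bs \<in> lists Basis" for bs
    using that
  proof (induction bs)
    case (Cons b bs)
    then show ?case
      by (simp add: partial_deriv_eq[OF deriv]) (simp add: partial_deriv_def)
  qed simp
  show "(\<lambda>x. T (foldr partial_deriv bs f x)) differentiable (at x)" if "bs \<in> lists Basis" for bs x
    using deriv[OF that] by (auto simp: differentiable_def)
  show "bounded (range (\<lambda>x. norm x ^ k *\<^sub>R T (foldr partial_deriv bs f x)))" if "bs \<in> lists Basis" for bs k
    using bounded_linear_image[OF schwartz_bounded_deriv[OF f that, of k] T]
    by (simp add: image_image linear_scale[OF bounded_linear.linear[OF T]])
qed

lemma schwartz_cnj: "f \<in> schwartz \<Longrightarrow> (\<lambda>x. cnj (f x)) \<in> schwartz"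
  by (rule schwartz_linear_image[OF _ bounded_linear_cnj])

lemma schwartz_cmult: "f \<in> schwartz \<Longrightarrow> (\<lambda>x. c * f x) \<in> schwartz"
  by (rule schwartz_linear_image[OF _ bounded_linear_mult_right])

lemma schwartz_add:
  assumes f: "f \<in> schwartz" and g: "g \<in> schwartz"
  shows "(\<lambda>x. f x + g x) \<in> schwartz"
proof (rule schwartzI[where d = "\<lambda>bs x. foldr partial_deriv bs f x + foldr partial_deriv bs g x"])
  have deriv: "((\<lambda>x. foldr partial_deriv bs f x + foldr partial_deriv bs g x) has_derivative
      (\<lambda>h. frechet_derivative (foldr partial_deriv bs f) (at x) h
        + frechet_derivative (foldr partial_deriv bs g) (at x) h)) (at x)"
    if "bs \<in> lists Basis" for bs x
    by (rule has_derivative_add[OF schwartz_has_derivative[OF f that] schwartz_has_derivative[OF g that]])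
  show "foldr partial_deriv bs (\<lambda>x. f x + g x) = (\<lambda>x. foldr partial_deriv bs f x + foldr partial_deriv bs g x)"
    if "bs \<in> lists Basis" for bs
    using that
  proof (induction bs)
    case (Cons b bs)
    then show ?case
      by (simp add: partial_deriv_eq[OF deriv]) (simp add: partial_deriv_def)
  qed simp
  show "(\<lambda>x. foldr partial_deriv bs f x + foldr partial_deriv bs g x) differentiable (at x)"
    if "bs \<in> lists Basis" for bs x
    using deriv[OF that] by (auto simp: differentiable_def)
  show "bounded (range (\<lambda>x. norm x ^ k *\<^sub>R (foldr partial_deriv bs f x + foldr partial_deriv bs g x)))"
    if "bs \<in> lists Basis" for bs k
    using bounded_plus_comp[OF schwartz_bounded_deriv[OF f that, of k] schwartz_bounded_deriv[OF g that, of k]]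
    by (simp add: scaleR_add_right)
qed

lemma schwartz_borel_measurable [measurable_dest]: "f \<in> schwartz \<Longrightarrow> f \<in> borel_measurable borel"
  using schwartz_has_derivative[of f "[]"]
  by (auto intro!: borel_measurable_continuous_onI continuous_at_imp_continuous_on has_derivative_continuous)

lemma schwartz_bounded:
  assumes "f \<in> schwartz"
  obtains B where "\<And>x. norm (f x) \<le> B"
  using schwartz_bounded_deriv[OF assms, of "[]" 0] by (auto simp: bounded_iff)

lemma integrable_inverse_1_plus_square_lborel: "integrable lborel (\<lambda>x :: real. inverse (1 + x\<^sup>2))"
  using integrable_inverse_1_plus_square by (simp add: set_integrable_def)

text \<open>Decay of order 6 is enough: it dominates the product of \<open>1 + p\<^sup>2\<close>, \<open>1 + q\<^sup>2\<close> and \<open>1 + t\<^sup>2\<close>,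
  whose reciprocal is integrable by Tonelli.\<close>

lemma schwartz_integrable:
  fixes f :: "heis \<Rightarrow> complex"
  assumes f: "f \<in> schwartz"
  shows "integrable lborel f"
proof -
  let ?w = "\<lambda>x :: real. complex_of_real (inverse (1 + x\<^sup>2))"
  have w: "integrable lborel ?w"
    using integrable_inverse_1_plus_square_lborel by (rule integrable_of_real)
  let ?W = "\<lambda>x :: heis. ?w (fst x) * (?w (fst (snd x)) * ?w (snd (snd x)))"
  have W: "integrable lborel ?W"
    by (rule integrable_lborel_product(1)[OF w integrable_lborel_product(1)[OF w w]])
  obtain B where B: "norm (f x) \<le> B" for x
    using schwartz_bounded[OF f] by blast
  obtain B6 where B6: "norm x ^ 6 * norm (f x) \<le> B6" for x
    using schwartz_bounded_deriv[OF f, of "[]" 6] by (auto simp: bounded_iff)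
  show ?thesis
  proof (rule Bochner_Integration.integrable_bound)
    show "integrable lborel (\<lambda>x. of_real (8 * (B + B6)) * ?W x)"
      by (intro integrable_mult_right W)
    show "AE x in lborel. norm (f x) \<le> norm (of_real (8 * (B + B6)) * ?W x)"
    proof (rule AE_I2)
      fix x :: heis
      obtain p q t where x: "x = (p, q, t)" by (cases x)
      have n: "\<bar>p\<bar> \<le> norm x" "\<bar>q\<bar> \<le> norm x" "\<bar>t\<bar> \<le> norm x"
        using norm_fst_le[of p "(q, t)"] norm_snd_le[of "(q, t)" p] norm_fst_le[of q t] norm_snd_le[of t q]
        unfolding x by auto
      have sq: "1 + y\<^sup>2 \<le> 2 * max 1 (norm x) ^ 2" if "\<bar>y\<bar> \<le> norm x" for y :: real
      proof -
        have "y\<^sup>2 \<le> max 1 (norm x) ^ 2" using that by (intro abs_le_square_iff[THEN iffD1]) auto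
        moreover have "1 \<le> max 1 (norm x) ^ 2" by simp
        ultimately show ?thesis by linarith
      qed
      let ?D = "(1 + p\<^sup>2) * ((1 + q\<^sup>2) * (1 + t\<^sup>2))"
      have D: "?D > 0" by (intro mult_pos_pos add_pos_nonneg) auto
      have "?D \<le> (2 * max 1 (norm x) ^ 2) * ((2 * max 1 (norm x) ^ 2) * (2 * max 1 (norm x) ^ 2))"
        by (intro mult_mono sq n) auto
      also have "\<dots> = 8 * max 1 (norm x) ^ 6" by simp
      also have "\<dots> \<le> 8 * (1 + norm x ^ 6)" by (simp add: max_def)
      finally have "norm (f x) * ?D \<le> norm (f x) * (8 * (1 + norm x ^ 6))"
        by (rule mult_left_mono) simp
      also have "\<dots> \<le> 8 * (B + B6)"
        using B[of x] B6[of x] by (simp add: algebra_simps)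
      finally have "norm (f x) \<le> 8 * (B + B6) / ?D"
        using D by (simp add: pos_le_divide_eq)
      also have "\<dots> \<le> \<bar>8 * (B + B6)\<bar> / ?D"
        using D by (intro divide_right_mono) auto
      also have "\<dots> = norm (of_real (8 * (B + B6)) * ?W x)"
        unfolding norm_mult norm_of_real x by (simp add: field_simps abs_mult)
      finally show "norm (f x) \<le> norm (of_real (8 * (B + B6)) * ?W x)" .
    qed
  qed (use f in measurable)
qed

lemma schwartz_L2:
  fixes f :: "heis \<Rightarrow> complex"
  assumes f: "f \<in> schwartz"
  shows "f \<in> L2 lborel"
proof -
  obtain B where B: "norm (f x) \<le> B" for x
    using schwartz_bounded[OF f] by blast
  have "integrable lborel (\<lambda>x. f x * cnj (f x))"
    by (rule integrable_mult_bounded[OF schwartz_integrable[OF f], where B = B])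
      (use f B in \<open>auto intro!: borel_measurable_cnj schwartz_borel_measurable\<close>)
  then have "integrable lborel (\<lambda>x. norm (f x * cnj (f x)))"
    by (rule integrable_norm)
  then show ?thesis
    using schwartz_borel_measurable[OF f] by (simp add: L2_def norm_mult power2_eq_square)
qed

section \<open>Smooth approximations of intervals\<close>

text \<open>Explicit Schwartz functions are products of one-variable functions \<open>Q exp (- S)\<close> with
  polynomials \<open>Q\<close>, \<open>S\<close>. For fixed \<open>S\<close> these are closed under differentiation, which only changes
  \<open>Q\<close>, so that all iterated derivatives are controlled at once.\<close>

definition poly_exp :: "real poly \<Rightarrow> real poly \<Rightarrow> real \<Rightarrow> real" where
  "poly_exp S Q x = poly Q x * exp (- poly S x)"

lemma poly_exp_has_derivative:
  "(poly_exp S Q has_real_derivative poly_exp S (pderiv Q - Q * pderiv S) x) (at x)"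
  unfolding poly_exp_def[abs_def]
  by (auto intro!: derivative_eq_intros poly_DERIV simp: algebra_simps)

text \<open>As \<open>Q\<close> is arbitrary, boundedness is the same as decay faster than every power.\<close>

definition rapidly_growing :: "real poly \<Rightarrow> bool" where
  "rapidly_growing S \<longleftrightarrow> (\<forall>Q. bounded (range (poly_exp S Q)))"

definition poly_exp3 :: "real poly \<times> real poly \<times> real poly \<Rightarrow> real poly \<times> real poly \<times> real poly \<Rightarrow> heis \<Rightarrow> complex" where
  "poly_exp3 S Q x = complex_of_real (poly_exp (fst S) (fst Q) (fst x) *
     poly_exp (fst (snd S)) (fst (snd Q)) (fst (snd x)) * poly_exp (snd (snd S)) (snd (snd Q)) (snd (snd x)))"

lemma poly_exp3_has_derivative:
  "(poly_exp3 (S1, S2, S3) (Q1, Q2, Q3) has_derivative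
     (\<lambda>h. fst h *\<^sub>R poly_exp3 (S1, S2, S3) (pderiv Q1 - Q1 * pderiv S1, Q2, Q3) x +
          fst (snd h) *\<^sub>R poly_exp3 (S1, S2, S3) (Q1, pderiv Q2 - Q2 * pderiv S2, Q3) x +
          snd (snd h) *\<^sub>R poly_exp3 (S1, S2, S3) (Q1, Q2, pderiv Q3 - Q3 * pderiv S3) x)) (at x)"
proof -
  have 1: "((\<lambda>x. poly_exp S Q (l x)) has_derivative
      (\<lambda>h. l h * poly_exp S (pderiv Q - Q * pderiv S) (l x))) (at x)"
    if "bounded_linear l" for S Q and l :: "heis \<Rightarrow> real"
  proof -
    have l: "(l has_derivative l) (at x)"
      by (rule bounded_linear_imp_has_derivative[OF that])
    have g: "(poly_exp S Q has_derivative (*) (poly_exp S (pderiv Q - Q * pderiv S) (l x))) (at (l x))"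
      using poly_exp_has_derivative by (simp add: has_field_derivative_def)
    show ?thesis
      using has_derivative_compose[OF l g] by (simp only: mult.commute)
  qed
  have l: "bounded_linear (fst :: heis \<Rightarrow> real)" "bounded_linear (\<lambda>x :: heis. fst (snd x))"
    "bounded_linear (\<lambda>x :: heis. snd (snd x))"
    by (intro bounded_linear_fst bounded_linear_fst_comp bounded_linear_snd_comp bounded_linear_ident bounded_linear_snd)+
  show ?thesis
    unfolding poly_exp3_def[abs_def] fst_conv snd_conv
    by (rule has_derivative_eq_rhs[OF has_derivative_of_real[OF
          has_derivative_mult[OF has_derivative_mult[OF 1[OF l(1)] 1[OF l(2)]] 1[OF l(3)]]]])
      (simp add: fun_eq_iff scaleR_conv_of_real algebra_simps)
qed

lemma poly_exp3_schwartz: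
  assumes S: "rapidly_growing S1" "rapidly_growing S2" "rapidly_growing S3"
  shows "poly_exp3 (S1, S2, S3) (Q1, Q2, Q3) \<in> schwartz"
proof -
  let ?S = "(S1, S2, S3)"
  have diff: "poly_exp3 ?S Q differentiable (at x)" for Q x
  proof -
    obtain Q1 Q2 Q3 where Q: "Q = (Q1, Q2, Q3)" by (cases Q)
    show ?thesis
      unfolding Q differentiable_def by (rule exI, rule poly_exp3_has_derivative)
  qed
  have "\<exists>Q'. partial_deriv b (poly_exp3 ?S Q) = poly_exp3 ?S Q'" if "b \<in> Basis" for b Q
  proof -
    obtain Q1 Q2 Q3 where Q: "Q = (Q1, Q2, Q3)" by (cases Q)
    have "b = (1, 0, 0) \<or> b = (0, 1, 0) \<or> b = (0, 0, 1)"
      using that by (auto simp: Basis_prod_def zero_prod_def)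
    then show ?thesis
    proof (elim disjE)
      assume "b = (1, 0, 0)"
      then have "partial_deriv b (poly_exp3 ?S Q) = poly_exp3 ?S (pderiv Q1 - Q1 * pderiv S1, Q2, Q3)"
        unfolding Q partial_deriv_eq[OF poly_exp3_has_derivative] by simp
      then show ?thesis by (rule exI)
    next
      assume "b = (0, 1, 0)"
      then have "partial_deriv b (poly_exp3 ?S Q) = poly_exp3 ?S (Q1, pderiv Q2 - Q2 * pderiv S2, Q3)"
        unfolding Q partial_deriv_eq[OF poly_exp3_has_derivative] by simp
      then show ?thesis by (rule exI)
    next
      assume "b = (0, 0, 1)"
      then have "partial_deriv b (poly_exp3 ?S Q) = poly_exp3 ?S (Q1, Q2, pderiv Q3 - Q3 * pderiv S3)"
        unfolding Q partial_deriv_eq[OF poly_exp3_has_derivative] by simp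
      then show ?thesis by (rule exI)
    qed
  qed
  note partial = this
  have iter: "\<exists>Q'. foldr partial_deriv bs (poly_exp3 ?S Q) = poly_exp3 ?S Q'" if "bs \<in> lists Basis" for bs Q
    using that
  proof (induction bs)
    case Nil
    show ?case by (rule exI[of _ Q]) simp
  next
    case (Cons b bs)
    then obtain Q' where "foldr partial_deriv bs (poly_exp3 ?S Q) = poly_exp3 ?S Q'" by auto
    then show ?case using partial[of b Q'] Cons by auto
  qed
  have bdd: "bounded (range (\<lambda>x. norm x ^ k *\<^sub>R poly_exp3 ?S Q x))" for k Q
  proof -
    obtain Q1 Q2 Q3 where Q: "Q = (Q1, Q2, Q3)" by (cases Q)
    \<comment> \<open>The weight \<open>norm x ^ k\<close> is at most the \<open>k\<close>-th power of a product of factors \<open>1 + y\<^sup>2\<close>, one per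
      coordinate, and each of them is absorbed into the polynomial factor.\<close>
    let ?P = "[:1, 0, 1:] ^ k :: real poly"
    obtain B1 where B1: "\<bar>poly_exp S1 (Q1 * ?P) y\<bar> \<le> B1" for y
      using S(1) by (auto simp: rapidly_growing_def bounded_iff)
    obtain B2 where B2: "\<bar>poly_exp S2 (Q2 * ?P) y\<bar> \<le> B2" for y
      using S(2) by (auto simp: rapidly_growing_def bounded_iff)
    obtain B3 where B3: "\<bar>poly_exp S3 (Q3 * ?P) y\<bar> \<le> B3" for y
      using S(3) by (auto simp: rapidly_growing_def bounded_iff)
    have pe: "poly_exp R (Q * ?P) y = (1 + y\<^sup>2) ^ k * poly_exp R Q y" for R Q y
      by (simp add: poly_exp_def power2_eq_square)
    have "norm (norm x ^ k *\<^sub>R poly_exp3 ?S Q x) \<le> B1 * B2 * B3" for x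
    proof -
      obtain p q t where x: "x = (p, q, t)" by (cases x)
      have "norm x \<le> 1 + (p\<^sup>2 + q\<^sup>2 + t\<^sup>2)"
        unfolding x norm_prod_def
        by (rule real_le_lsqrt) (auto simp: power2_eq_square[of "1 + _"] algebra_simps)
      also have "\<dots> \<le> (1 + p\<^sup>2) * (1 + q\<^sup>2) * (1 + t\<^sup>2)"
        by (simp add: algebra_simps)
      finally have "norm x ^ k \<le> ((1 + p\<^sup>2) * (1 + q\<^sup>2) * (1 + t\<^sup>2)) ^ k"
        by (rule power_mono) simp
      then have "norm x ^ k * norm (poly_exp3 ?S Q x) \<le> ((1 + p\<^sup>2) * (1 + q\<^sup>2) * (1 + t\<^sup>2)) ^ k * norm (poly_exp3 ?S Q x)"
        by (rule mult_right_mono) simp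
      also have "\<dots> = \<bar>poly_exp S1 (Q1 * ?P) p\<bar> * \<bar>poly_exp S2 (Q2 * ?P) q\<bar> * \<bar>poly_exp S3 (Q3 * ?P) t\<bar>"
        unfolding pe poly_exp3_def norm_of_real x Q fst_conv snd_conv by (simp add: power_mult_distrib abs_mult)
      also have "\<dots> \<le> B1 * B2 * B3"
        using order_trans[OF abs_ge_zero B1] order_trans[OF abs_ge_zero B2] by (intro mult_mono B1 B2 B3) auto
      finally show ?thesis by simp
    qed
    then show ?thesis by (auto simp: bounded_iff)
  qed
  show ?thesis
    unfolding schwartz_def
  proof (intro CollectI ballI conjI allI)
    fix bs :: "heis list" and x :: heis and k :: nat
    assume "bs \<in> lists Basis"
    then obtain Q' where Q': "foldr partial_deriv bs (poly_exp3 ?S (Q1, Q2, Q3)) = poly_exp3 ?S Q'"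
      using iter by blast
    show "foldr partial_deriv bs (poly_exp3 ?S (Q1, Q2, Q3)) differentiable (at x)"
      unfolding Q' by (rule diff)
    show "bounded (range (\<lambda>x. norm x ^ k *\<^sub>R foldr partial_deriv bs (poly_exp3 ?S (Q1, Q2, Q3)) x))"
      unfolding Q' by (rule bdd)
  qed
qed

text \<open>With \<open>m = Suc n\<close> and \<open>y = (x - c) / r\<close> the exponent is \<open>m * y ^ (2 * m)\<close>. The negative exponential
  tends to 1 where \<open>\<bar>y\<bar> < 1\<close> and to 0 elsewhere. The factor \<open>m\<close> takes care of the endpoints, so the
  limit is the indicator of an open interval everywhere and not merely almost everywhere.\<close>

definition bump_exponent :: "nat \<Rightarrow> real \<Rightarrow> real \<Rightarrow> real poly" where
  "bump_exponent n c r = smult (real (Suc n)) ([:- c / r, 1 / r:] ^ (2 * Suc n))"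

lemma poly_bump_exponent: "poly (bump_exponent n c r) x = real (Suc n) * ((x - c) / r) ^ (2 * Suc n)"
  by (simp add: bump_exponent_def poly_power diff_divide_distrib del: power_Suc of_nat_Suc mult_Suc_right)

text \<open>A Gaussian majorant that does not depend on \<open>n\<close>, for dominated convergence. The 1 in the
  exponent covers \<open>\<bar>y\<bar> \<le> 1\<close>, where \<open>y\<^sup>2\<close> may exceed higher powers of itself.\<close>

lemma exp_bump_le: "exp (- poly (bump_exponent n c r) x) \<le> exp (1 - ((x - c) / r)\<^sup>2)"
proof -
  let ?y = "((x - c) / r)\<^sup>2"
  have "?y - 1 \<le> 1 * ?y ^ Suc n"
  proof (cases "?y \<le> 1")
    case False
    then show ?thesis using self_le_power[of ?y "Suc n"] by (smt (verit) zero_less_Suc)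
  qed (smt (verit) zero_le_power zero_le_power2)
  also have "1 * ?y ^ Suc n \<le> real (Suc n) * ?y ^ Suc n"
    by (rule mult_right_mono) auto
  also have "\<dots> = poly (bump_exponent n c r) x"
    unfolding poly_bump_exponent power_mult ..
  finally show ?thesis by simp
qed

lemma rapidly_growing_bump_exponent:
  assumes "r \<noteq> 0"
  shows "rapidly_growing (bump_exponent n c r)"
  unfolding rapidly_growing_def
proof
  fix Q
  let ?R = "pcompose Q [:c, r:]"
  let ?B = "\<Sum>i\<le>degree ?R. \<bar>coeff ?R i\<bar> * (real i ^ i * exp 2)"
  \<comment> \<open>From \<open>u \<le> exp u\<close> with \<open>u = \<bar>y\<bar> / i\<close>, and \<open>\<bar>y\<bar> + 1 - y\<^sup>2 \<le> 2\<close>.\<close>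
  have mono: "\<bar>y\<bar> ^ i * exp (1 - y\<^sup>2) \<le> real i ^ i * exp 2" for y :: real and i
  proof -
    have "\<bar>y\<bar> ^ i \<le> real i ^ i * exp \<bar>y\<bar>"
    proof (cases "i = 0")
      case False
      have "(\<bar>y\<bar> / real i) ^ i \<le> exp (\<bar>y\<bar> / real i) ^ i"
        by (intro power_mono) (smt (verit) exp_ge_add_one_self, simp)
      also have "\<dots> = exp \<bar>y\<bar>" using False by (simp add: exp_of_nat_mult[symmetric])
      finally show ?thesis using False by (simp add: power_divide field_simps)
    qed simp
    then have "\<bar>y\<bar> ^ i * exp (1 - y\<^sup>2) \<le> real i ^ i * (exp \<bar>y\<bar> * exp (1 - y\<^sup>2))"
      by (metis mult.assoc mult_right_mono exp_ge_zero)
    also have "exp \<bar>y\<bar> * exp (1 - y\<^sup>2) \<le> exp 2"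
    proof -
      have "0 \<le> (\<bar>y\<bar> - 1)\<^sup>2" by simp
      then have "2 * \<bar>y\<bar> \<le> y\<^sup>2 + 1" by (simp add: power2_diff)
      moreover have "0 \<le> y\<^sup>2" by simp
      ultimately have "\<bar>y\<bar> + (1 - y\<^sup>2) \<le> 2" by (smt (verit))
      then show ?thesis by (simp add: exp_add[symmetric])
    qed
    finally show ?thesis by (simp add: mult_left_mono)
  qed
  have "\<bar>poly_exp (bump_exponent n c r) Q x\<bar> \<le> ?B" for x
  proof -
    let ?y = "(x - c) / r"
    have "poly Q x = poly ?R ?y" using assms by (simp add: poly_pcompose)
    then have "\<bar>poly Q x\<bar> \<le> (\<Sum>i\<le>degree ?R. \<bar>coeff ?R i\<bar> * \<bar>?y\<bar> ^ i)"
      unfolding poly_altdef by (simp add: order_trans[OF sum_abs] abs_mult power_abs)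
    then have "\<bar>poly Q x\<bar> * exp (- poly (bump_exponent n c r) x) \<le> (\<Sum>i\<le>degree ?R. \<bar>coeff ?R i\<bar> * \<bar>?y\<bar> ^ i) * exp (1 - ?y\<^sup>2)"
      by (intro mult_mono exp_bump_le) (auto intro!: sum_nonneg)
    also have "\<dots> = (\<Sum>i\<le>degree ?R. \<bar>coeff ?R i\<bar> * (\<bar>?y\<bar> ^ i * exp (1 - ?y\<^sup>2)))"
      by (simp add: sum_distrib_right mult.assoc)
    also have "\<dots> \<le> ?B" by (intro sum_mono mult_left_mono mono) auto
    finally show ?thesis by (simp add: poly_exp_def abs_mult)
  qed
  then show "bounded (range (poly_exp (bump_exponent n c r) Q))"
    by (auto simp: bounded_iff)
qed

lemma exp_bump_tendsto:
  assumes "r > 0"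
  shows "(\<lambda>n. exp (- poly (bump_exponent n c r) x)) \<longlonglongrightarrow> indicator {c - r<..<c + r} x"
proof -
  let ?z = "((x - c) / r)\<^sup>2"
  have eq: "poly (bump_exponent n c r) x = real (Suc n) * ?z ^ Suc n" for n
    unfolding poly_bump_exponent power_mult ..
  have z: "?z < 1 \<longleftrightarrow> x \<in> {c - r<..<c + r}"
    using assms unfolding abs_square_less_1 by (auto simp: abs_less_iff field_simps)
  have z0: "0 \<le> ?z" by simp
  show ?thesis
  proof (cases "x \<in> {c - r<..<c + r}")
    case True
    then have "(\<lambda>n. real n * ?z ^ n) \<longlonglongrightarrow> 0"
      using z z0 by (intro powser_times_n_limit_0) auto
    then have "(\<lambda>n. exp (- (real (Suc n) * ?z ^ Suc n))) \<longlonglongrightarrow> exp (- 0)"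
      by (intro tendsto_intros LIMSEQ_Suc)
    then show ?thesis using True by (simp only: eq) simp
  next
    case False
    then have z1: "1 \<le> ?z" using z by auto
    have "(\<lambda>n. exp (- (real (Suc n) * ?z ^ Suc n))) \<longlonglongrightarrow> 0"
    proof (rule tendsto_sandwich[OF _ _ tendsto_const])
      show "\<forall>\<^sub>F n in sequentially. exp (- (real (Suc n) * ?z ^ Suc n)) \<le> exp (- real (Suc n))"
      proof (rule always_eventually, rule allI)
        fix n
        have "real (Suc n) * 1 \<le> real (Suc n) * ?z ^ Suc n"
          by (intro mult_left_mono one_le_power z1) simp
        then show "exp (- (real (Suc n) * ?z ^ Suc n)) \<le> exp (- real (Suc n))"
          by (simp only: exp_le_cancel_iff neg_le_iff_le mult_1_right)
      qed
      show "(\<lambda>n. exp (- real (Suc n))) \<longlonglongrightarrow> 0"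
        by (rule LIMSEQ_Suc) (rule filterlim_compose[OF exp_at_bot filterlim_compose[OF filterlim_uminus_at_bot_at_top filterlim_real_sequentially]])
    qed simp
    then show ?thesis using False by (simp only: eq) simp
  qed
qed

section \<open>Density of the Schwartz functions\<close>

text \<open>The parameter \<open>d\<close> allows the constant in front of the first square to be arbitrarily close
  to 1, at the expense of the second.\<close>

lemma cmod_add_square_le:
  assumes "0 < d"
  shows "(cmod (z + w))\<^sup>2 \<le> (1 + d) * (cmod z)\<^sup>2 + (1 + 1 / d) * (cmod w)\<^sup>2"
proof -
  have "0 \<le> (d * cmod z - cmod w)\<^sup>2 / d"
    using assms by simp
  also have "\<dots> = d * (cmod z)\<^sup>2 + (cmod w)\<^sup>2 / d - 2 * cmod z * cmod w"
    using assms by (simp add: power2_eq_square field_simps)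
  finally have "(cmod z + cmod w)\<^sup>2 \<le> (1 + d) * (cmod z)\<^sup>2 + (1 + 1 / d) * (cmod w)\<^sup>2"
    by (simp add: power2_sum algebra_simps)
  moreover have "(cmod (z + w))\<^sup>2 \<le> (cmod z + cmod w)\<^sup>2"
    by (intro power_mono norm_triangle_ineq) auto
  ultimately show ?thesis by linarith
qed

lemma L2_measurable: "f \<in> L2 M \<Longrightarrow> f \<in> borel_measurable M"
  and L2_integrable: "f \<in> L2 M \<Longrightarrow> integrable M (\<lambda>x. (cmod (f x))\<^sup>2)"
  by (auto simp: L2_def)

lemma L2_dominated:
  assumes "f \<in> borel_measurable M" "integrable M h" "\<And>x. (cmod (f x))\<^sup>2 \<le> h x"
  shows "f \<in> L2 M"
proof -
  have "integrable M (\<lambda>x. (cmod (f x))\<^sup>2)"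
  proof (rule Bochner_Integration.integrable_bound[OF assms(2)])
    show "AE x in M. norm ((cmod (f x))\<^sup>2) \<le> norm (h x)"
      using assms(3) by (intro AE_I2) (simp add: order_trans[OF _ abs_ge_self])
  qed (use assms(1) in measurable)
  with assms(1) show ?thesis by (simp add: L2_def)
qed

lemma L2_add:
  assumes f: "f \<in> L2 M" and g: "g \<in> L2 M"
  shows "(\<lambda>x. f x + g x) \<in> L2 M"
proof (rule L2_dominated[where h = "\<lambda>x. 2 * (cmod (f x))\<^sup>2 + 2 * (cmod (g x))\<^sup>2"])
  show "integrable M (\<lambda>x. 2 * (cmod (f x))\<^sup>2 + 2 * (cmod (g x))\<^sup>2)"
    using L2_integrable[OF f] L2_integrable[OF g] by auto
  show "(cmod (f x + g x))\<^sup>2 \<le> 2 * (cmod (f x))\<^sup>2 + 2 * (cmod (g x))\<^sup>2" for x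
    using cmod_add_square_le[of 1 "f x" "g x"] by simp
  show "(\<lambda>x. f x + g x) \<in> borel_measurable M"
    using L2_measurable[OF f] L2_measurable[OF g] by measurable
qed

lemma L2_cmult: "f \<in> L2 M \<Longrightarrow> (\<lambda>x. c * f x) \<in> L2 M"
  by (auto simp: L2_def norm_mult power_mult_distrib)

lemma L2_diff: "f \<in> L2 M \<Longrightarrow> g \<in> L2 M \<Longrightarrow> (\<lambda>x. f x - g x) \<in> L2 M"
  using L2_add[of f M "\<lambda>x. - 1 * g x"] L2_cmult[of g M "- 1"] by simp

lemma integral_cmod_add_square_le:
  assumes f: "f \<in> L2 M" and g: "g \<in> L2 M" and d: "0 < d"
  shows "(LINT x|M. (cmod (f x + g x))\<^sup>2)
    \<le> (1 + d) * (LINT x|M. (cmod (f x))\<^sup>2) + (1 + 1 / d) * (LINT x|M. (cmod (g x))\<^sup>2)"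
proof -
  note [simp] = L2_integrable[OF f] L2_integrable[OF g]
  have "(LINT x|M. (cmod (f x + g x))\<^sup>2) \<le> (LINT x|M. (1 + d) * (cmod (f x))\<^sup>2 + (1 + 1 / d) * (cmod (g x))\<^sup>2)"
    using L2_integrable[OF L2_add[OF f g]]
    by (intro integral_mono cmod_add_square_le d) auto
  then show ?thesis by simp
qed

text \<open>The \<open>L\<^sup>2\<close>-closure of the Schwartz functions.\<close>

definition schwartz_approximable :: "(heis \<Rightarrow> complex) \<Rightarrow> bool" where
  "schwartz_approximable f \<longleftrightarrow> f \<in> L2 lborel \<and>
     (\<forall>e>0. \<exists>g\<in>schwartz. (LINT x|lborel. (cmod (f x - g x))\<^sup>2) < e)"

lemma schwartz_approximable_schwartz: "f \<in> schwartz \<Longrightarrow> schwartz_approximable f"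
  unfolding schwartz_approximable_def using schwartz_L2 by (auto intro!: bexI[of _ f])

lemma schwartz_approximableD:
  assumes "schwartz_approximable f" "e > 0"
  obtains g where "g \<in> schwartz" "(LINT x|lborel. (cmod (f x - g x))\<^sup>2) < e"
  using assms unfolding schwartz_approximable_def by blast

lemma schwartz_approximable_add:
  assumes f: "schwartz_approximable f" and g: "schwartz_approximable g"
  shows "schwartz_approximable (\<lambda>x. f x + g x)"
  unfolding schwartz_approximable_def
proof (intro conjI allI impI)
  have L2: "f \<in> L2 lborel" "g \<in> L2 lborel"
    using f g by (auto simp: schwartz_approximable_def)
  then show "(\<lambda>x. f x + g x) \<in> L2 lborel" by (rule L2_add)
  fix e :: real assume "e > 0"
  then have e4: "e / 4 > 0" by simp
  obtain f' where f': "f' \<in> schwartz" "(LINT x|lborel. (cmod (f x - f' x))\<^sup>2) < e / 4"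
    by (rule schwartz_approximableD[OF f e4])
  obtain g' where g': "g' \<in> schwartz" "(LINT x|lborel. (cmod (g x - g' x))\<^sup>2) < e / 4"
    by (rule schwartz_approximableD[OF g e4])
  have "(LINT x|lborel. (cmod ((f x - f' x) + (g x - g' x)))\<^sup>2)
      \<le> 2 * (LINT x|lborel. (cmod (f x - f' x))\<^sup>2) + 2 * (LINT x|lborel. (cmod (g x - g' x))\<^sup>2)"
    using integral_cmod_add_square_le[OF L2_diff[OF L2(1) schwartz_L2[OF f'(1)]]
      L2_diff[OF L2(2) schwartz_L2[OF g'(1)]], of 1] by simp
  then have "(LINT x|lborel. (cmod ((f x + g x) - (f' x + g' x)))\<^sup>2) < e"
    using f'(2) g'(2) by (simp add: algebra_simps)
  then show "\<exists>h\<in>schwartz. (LINT x|lborel. (cmod ((f x + g x) - h x))\<^sup>2) < e"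
    by (intro bexI[of _ "\<lambda>x. f' x + g' x"] schwartz_add f' g')
qed

lemma schwartz_approximable_cmult:
  assumes f: "schwartz_approximable f"
  shows "schwartz_approximable (\<lambda>x. c * f x)"
  unfolding schwartz_approximable_def
proof (intro conjI allI impI)
  show "(\<lambda>x. c * f x) \<in> L2 lborel"
    using f by (auto simp: schwartz_approximable_def intro: L2_cmult)
  fix e :: real assume e: "e > 0"
  have c: "0 < (cmod c)\<^sup>2 + 1" by (simp add: add_nonneg_pos)
  have "0 < e / ((cmod c)\<^sup>2 + 1)" using e c by simp
  then obtain g where g: "g \<in> schwartz" "(LINT x|lborel. (cmod (f x - g x))\<^sup>2) < e / ((cmod c)\<^sup>2 + 1)"
    by (rule schwartz_approximableD[OF f])
  have "(LINT x|lborel. (cmod (c * f x - c * g x))\<^sup>2) = (cmod c)\<^sup>2 * (LINT x|lborel. (cmod (f x - g x))\<^sup>2)"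
    by (simp add: right_diff_distrib[symmetric] norm_mult power_mult_distrib)
  also have "\<dots> \<le> ((cmod c)\<^sup>2 + 1) * (LINT x|lborel. (cmod (f x - g x))\<^sup>2)"
    by (intro mult_right_mono) auto
  also have "\<dots> < e"
    using g(2) c by (simp add: pos_less_divide_eq mult.commute)
  finally show "\<exists>h\<in>schwartz. (LINT x|lborel. (cmod (c * f x - h x))\<^sup>2) < e"
    by (intro bexI[of _ "\<lambda>x. c * g x"] schwartz_cmult g(1))
qed

text \<open>The class is closed under dominated pointwise limits: dominated convergence turns them into
  \<open>L\<^sup>2\<close> limits.\<close>

lemma schwartz_approximable_limit:
  assumes f: "\<And>n. schwartz_approximable (f n)"
    and lim: "\<And>x. (\<lambda>n. f n x) \<longlonglongrightarrow> l x"
    and bound: "\<And>n x. (cmod (f n x))\<^sup>2 \<le> h x" and h: "integrable lborel h"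
  shows "schwartz_approximable l"
  unfolding schwartz_approximable_def
proof (intro conjI allI impI)
  have fL2: "f n \<in> L2 lborel" for n
    using f by (auto simp: schwartz_approximable_def)
  have fm [measurable]: "f n \<in> borel_measurable lborel" for n
    using L2_measurable[OF fL2] .
  have lm [measurable]: "l \<in> borel_measurable lborel"
    using lim by (rule borel_measurable_LIMSEQ_metric[OF fm])
  have lb: "(cmod (l x))\<^sup>2 \<le> h x" for x
    by (rule LIMSEQ_le_const2[OF tendsto_power[OF tendsto_norm[OF lim]]]) (use bound in auto)
  show l: "l \<in> L2 lborel"
    by (rule L2_dominated[OF lm h lb])
  fix e :: real assume e: "e > 0"
  have "(\<lambda>n. LINT x|lborel. (cmod (l x - f n x))\<^sup>2) \<longlonglongrightarrow> (LINT x|(lborel :: heis measure). 0 :: real)"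
  proof (rule integral_dominated_convergence[where f = "\<lambda>x. 0 :: real" and s = "\<lambda>n x. (cmod (l x - f n x))\<^sup>2"
        and w = "\<lambda>x. 4 * h x"])
    show "AE x in lborel. (\<lambda>n. (cmod (l x - f n x))\<^sup>2) \<longlonglongrightarrow> 0"
    proof (rule AE_I2)
      fix x
      have "(\<lambda>n. (cmod (l x - f n x))\<^sup>2) \<longlonglongrightarrow> (cmod (l x - l x))\<^sup>2"
        by (intro tendsto_intros lim)
      then show "(\<lambda>n. (cmod (l x - f n x))\<^sup>2) \<longlonglongrightarrow> 0" by simp
    qed
    show "AE x in lborel. norm ((cmod (l x - f n x))\<^sup>2) \<le> 4 * h x" for n
    proof (rule AE_I2)
      fix x
      have "(cmod (l x + - f n x))\<^sup>2 \<le> 2 * (cmod (l x))\<^sup>2 + 2 * (cmod (- f n x))\<^sup>2"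
        using cmod_add_square_le[of 1 "l x" "- f n x"] by simp
      then show "norm ((cmod (l x - f n x))\<^sup>2) \<le> 4 * h x"
        using lb[of x] bound[of n x] by simp
    qed
  qed (use h in auto)
  then have "\<forall>\<^sub>F n in sequentially. (LINT x|lborel. (cmod (l x - f n x))\<^sup>2) < e / 4"
    using e by (intro order_tendstoD(2)[where y = "LINT x|(lborel :: heis measure). 0 :: real"]) auto
  then obtain n where n: "(LINT x|lborel. (cmod (l x - f n x))\<^sup>2) < e / 4"
    by (auto simp: eventually_sequentially)
  have "0 < e / 4" using e by simp
  then obtain g where g: "g \<in> schwartz" "(LINT x|lborel. (cmod (f n x - g x))\<^sup>2) < e / 4"
    by (rule schwartz_approximableD[OF f])
  have "(LINT x|lborel. (cmod ((l x - f n x) + (f n x - g x)))\<^sup>2)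
      \<le> 2 * (LINT x|lborel. (cmod (l x - f n x))\<^sup>2) + 2 * (LINT x|lborel. (cmod (f n x - g x))\<^sup>2)"
    using integral_cmod_add_square_le[OF L2_diff[OF l fL2[of n]]
      L2_diff[OF fL2[of n] schwartz_L2[OF g(1)]], of 1] by simp
  then show "\<exists>g\<in>schwartz. (LINT x|lborel. (cmod (l x - g x))\<^sup>2) < e"
    using n g by (intro bexI[of _ g]) auto
qed

lemma schwartz_approximable_zero: "schwartz_approximable (\<lambda>x. 0)"
proof -
  have "rapidly_growing (bump_exponent 0 0 1)"
    by (rule rapidly_growing_bump_exponent) simp
  from schwartz_cmult[OF poly_exp3_schwartz[OF this this this], of 0]
  show ?thesis by (intro schwartz_approximable_schwartz) simp
qed

lemma schwartz_approximable_sum: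
  assumes "finite I" "\<And>i. i \<in> I \<Longrightarrow> schwartz_approximable (f i)"
  shows "schwartz_approximable (\<lambda>x. \<Sum>i\<in>I. f i x)"
  using assms by (induction I rule: finite_induct)
    (auto intro: schwartz_approximable_zero schwartz_approximable_add)

lemma mem_box_heis:
  fixes a b x :: heis
  shows "x \<in> box a b \<longleftrightarrow> fst x \<in> {fst a<..<fst b} \<and> fst (snd x) \<in> {fst (snd a)<..<fst (snd b)}
    \<and> snd (snd x) \<in> {snd (snd a)<..<snd (snd b)}"
  by (cases x; cases a; cases b) (auto simp: mem_box Basis_prod_def ball_Un)

lemma integrable_gaussian_bump:
  fixes c r :: real
  assumes "r > 0"
  shows "integrable lborel (\<lambda>x. exp (1 - ((x - c) / r)\<^sup>2))"
proof -
  have "exp (1 - y\<^sup>2) \<le> exp 1 * inverse (1 + y\<^sup>2)" for y :: real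
  proof -
    have "inverse (exp (y\<^sup>2)) \<le> inverse (1 + y\<^sup>2)"
      by (intro le_imp_inverse_le exp_ge_add_one_self) (simp add: add_pos_nonneg)
    then show ?thesis by (simp add: exp_diff divide_inverse)
  qed
  then have "integrable lborel (\<lambda>y :: real. exp (1 - y\<^sup>2))"
    by (intro Bochner_Integration.integrable_bound[OF integrable_mult_right[OF integrable_inverse_1_plus_square_lborel, of "exp 1"]])
      (auto intro!: AE_I2 simp: order_trans[OF _ abs_ge_self])
  from lborel_integrable_real_affine[OF this, where c = "1 / r" and t = "- c / r"]
  show ?thesis using assms by (simp add: diff_divide_distrib add.commute)
qed

text \<open>The bump functions of the three coordinates converge to the indicators of the three sides, under
  a Gaussian majorant.\<close>

lemma schwartz_approximable_indicator_box:
  fixes a b :: heis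
  shows "schwartz_approximable (indicator (box a b))"
proof (cases "box a b = {}")
  case True
  then have "(indicator (box a b) :: heis \<Rightarrow> complex) = (\<lambda>x. 0)"
    by auto
  then show ?thesis by (simp add: schwartz_approximable_zero)
next
  case False
  obtain a1 a2 a3 b1 b2 b3 where ab: "a = (a1, a2, a3)" "b = (b1, b2, b3)"
    by (cases a; cases b)
  have lt: "a1 < b1" "a2 < b2" "a3 < b3"
    using False by (auto simp: mem_box_heis ab)
  define S where "S n a b = bump_exponent n ((a + b) / 2) ((b - a) / 2)" for n a b
  define G where "G a b x = exp (1 - ((x - (a + b) / 2) / ((b - a) / 2))\<^sup>2)" for a b x :: real
  have S: "rapidly_growing (S n a b)" if "a < b" for n a b
    unfolding S_def using that by (intro rapidly_growing_bump_exponent) auto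
  have lim: "(\<lambda>n. exp (- poly (S n a b) x)) \<longlonglongrightarrow> indicator {a<..<b} x" if "a < b" for a b x
  proof -
    have "(a + b) / 2 - (b - a) / 2 = a" "(a + b) / 2 + (b - a) / 2 = b"
      by (auto simp: field_simps)
    then show ?thesis
      unfolding S_def using exp_bump_tendsto[of "(b - a) / 2" "(a + b) / 2" x] that by simp
  qed
  have G: "integrable lborel (\<lambda>x. complex_of_real ((G a b x)\<^sup>2))" if "a < b" for a b
  proof -
    have "exp (1 - y\<^sup>2) \<le> exp 1" for y :: real by simp
    then have "(exp (1 - y\<^sup>2))\<^sup>2 \<le> exp 1 * exp (1 - y\<^sup>2)" for y :: real
      unfolding power2_eq_square by (intro mult_right_mono) auto
    moreover have "integrable lborel (\<lambda>x. exp 1 * G a b x)"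
      unfolding G_def using that by (intro integrable_mult_right integrable_gaussian_bump) simp
    ultimately have "integrable lborel (\<lambda>x. (G a b x)\<^sup>2)"
      by (elim Bochner_Integration.integrable_bound) (auto intro!: AE_I2 simp: G_def)
    then show ?thesis by (rule integrable_of_real)
  qed
  have SG: "exp (- poly (S n a b) x) \<le> G a b x" for n a b x
    unfolding S_def G_def by (rule exp_bump_le)
  let ?f = "\<lambda>n. poly_exp3 (S n a1 b1, S n a2 b2, S n a3 b3) (1, 1, 1)"
  let ?h = "\<lambda>x :: heis. (G a1 b1 (fst x))\<^sup>2 * ((G a2 b2 (fst (snd x)))\<^sup>2 * (G a3 b3 (snd (snd x)))\<^sup>2)"
  have f: "?f n x = complex_of_real (exp (- poly (S n a1 b1) (fst x)) * exp (- poly (S n a2 b2) (fst (snd x)))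
      * exp (- poly (S n a3 b3) (snd (snd x))))" for n x
    by (simp add: poly_exp3_def poly_exp_def)
  show ?thesis
  proof (rule schwartz_approximable_limit[where f = ?f and h = ?h])
    show "schwartz_approximable (?f n)" for n
      by (intro schwartz_approximable_schwartz poly_exp3_schwartz S lt)
    show "(\<lambda>n. ?f n x) \<longlonglongrightarrow> indicator (box a b) x" for x
    proof -
      have "(\<lambda>n. ?f n x) \<longlonglongrightarrow> complex_of_real (indicator {a1<..<b1} (fst x) * indicator {a2<..<b2} (fst (snd x))
          * indicator {a3<..<b3} (snd (snd x)))"
        unfolding f by (intro tendsto_intros lim lt)
      also have "complex_of_real (indicator {a1<..<b1} (fst x) * indicator {a2<..<b2} (fst (snd x))
          * indicator {a3<..<b3} (snd (snd x))) = indicator (box a b) x"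
        by (simp add: indicator_def mem_box_heis ab)
      finally show ?thesis .
    qed
    show "(cmod (?f n x))\<^sup>2 \<le> ?h x" for n x
    proof -
      have "cmod (?f n x) = exp (- poly (S n a1 b1) (fst x)) * exp (- poly (S n a2 b2) (fst (snd x)))
        * exp (- poly (S n a3 b3) (snd (snd x)))"
        unfolding f norm_of_real by simp
      also have "\<dots> \<le> G a1 b1 (fst x) * G a2 b2 (fst (snd x)) * G a3 b3 (snd (snd x))"
        by (intro mult_mono SG) (auto simp: G_def)
      finally have "(cmod (?f n x))\<^sup>2 \<le> (G a1 b1 (fst x) * G a2 b2 (fst (snd x)) * G a3 b3 (snd (snd x)))\<^sup>2"
        by (rule power_mono) simp
      then show ?thesis by (simp add: power_mult_distrib mult.assoc)
    qed
    have "integrable lborel (\<lambda>x :: heis. complex_of_real ((G a1 b1 (fst x))\<^sup>2)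
      * (complex_of_real ((G a2 b2 (fst (snd x)))\<^sup>2) * complex_of_real ((G a3 b3 (snd (snd x)))\<^sup>2)))"
      by (rule integrable_lborel_product(1)[OF G[OF lt(1)] integrable_lborel_product(1)[OF G[OF lt(2)] G[OF lt(3)]]])
    then have "integrable lborel (\<lambda>x. complex_of_real (?h x))"
      by (simp only: of_real_mult)
    then show "integrable lborel ?h"
      by (simp only: complex_of_real_integrable_eq)
  qed
qed

lemma Int_stable_boxes: "Int_stable (range (\<lambda>(a, b). box a b :: 'a::euclidean_space set))"
  by (auto simp: Int_stable_def box_Int_box)

text \<open>Boxes form an intersection-stable generator, and inside a fixed box the sets with approximable
  indicator form a Dynkin system.\<close>

lemma schwartz_approximable_indicator:
  fixes a b :: heis
  assumes A: "A \<in> sets borel"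
  shows "schwartz_approximable (indicator (A \<inter> box a b))"
proof -
  let ?G = "range (\<lambda>(a, b). box a b) :: heis set set"
  have "Int_stable ?G" by (rule Int_stable_boxes)
  moreover have "?G \<subseteq> Pow UNIV" by simp
  moreover have "A \<in> sigma_sets UNIV ?G"
    using A unfolding borel_eq_box by (simp add: sets_measure_of)
  ultimately show ?thesis
  proof (induction rule: sigma_sets_induct_disjoint)
    case (basic A)
    then obtain c d where A: "A = box c d" by auto
    show ?case
      unfolding A box_Int_box by (rule schwartz_approximable_indicator_box)
  next
    case empty
    then show ?case by (simp add: schwartz_approximable_zero)
  next
    case (compl A)
    have "(indicator ((UNIV - A) \<inter> box a b) :: heis \<Rightarrow> complex)
        = (\<lambda>x. indicator (box a b) x + - 1 * indicator (A \<inter> box a b) x)"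
      by (auto simp: indicator_def fun_eq_iff)
    then show ?case
      using compl by (simp only:) (intro schwartz_approximable_add schwartz_approximable_cmult
        schwartz_approximable_indicator_box)
  next
    case (union A)
    show ?case
    proof (rule schwartz_approximable_limit)
      show "schwartz_approximable (\<lambda>x. \<Sum>i<n. indicator (A i \<inter> box a b) x)" for n
        by (intro schwartz_approximable_sum union) auto
      have disj: "disjoint_family (\<lambda>i. A i \<inter> box a b)"
        using union(1) by (auto simp: disjoint_family_on_def)
      have sum: "(\<Sum>i<n. indicator (A i \<inter> box a b) x) = (indicator (\<Union>i<n. A i \<inter> box a b) x :: complex)" for n x
        by (rule indicator_UN_disjoint[symmetric]) (use disj in \<open>auto simp: disjoint_family_on_def\<close>)
      show "(\<lambda>n. \<Sum>i<n. indicator (A i \<inter> box a b) x) \<longlonglongrightarrow> (indicator ((\<Union>i. A i) \<inter> box a b) x :: complex)" for x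
        unfolding sum using LIMSEQ_indicator_UN[of "\<lambda>i. A i \<inter> box a b" x] by simp
      show "(cmod (\<Sum>i<n. indicator (A i \<inter> box a b) x))\<^sup>2 \<le> indicat_real (box a b) x" for n x
        unfolding sum by (auto simp: indicator_def)
      show "integrable lborel (indicat_real (box a b))"
        using emeasure_bounded_finite[OF bounded_box[of a b]] by (intro integrable_real_indicator) auto
    qed
  qed
qed

text \<open>A square integrable function is the limit of simple functions dominated by it. Cutting the
  \<open>n\<close>-th one off to a box of side \<open>2 n\<close> makes it a combination of the indicators above.\<close>

lemma schwartz_dense_L2:
  assumes f: "f \<in> L2 lborel"
  shows "schwartz_approximable f"
proof -
  have "f \<in> borel_measurable lborel" using L2_measurable[OF f] .
  from borel_measurable_implies_sequence_metric[OF this, of 0] obtain s where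
    s: "\<And>i. simple_function lborel (s i)" "\<And>x. (\<lambda>i. s i x) \<longlonglongrightarrow> f x" "\<And>i x. cmod (s i x) \<le> 2 * cmod (f x)"
    by auto
  let ?B = "\<lambda>n. box (- (real n, real n, real n)) (real n, real n, real n)"
  let ?f = "\<lambda>n x. s n x * indicator (?B n) x"
  show ?thesis
  proof (rule schwartz_approximable_limit[where f = ?f and h = "\<lambda>x. 4 * (cmod (f x))\<^sup>2"])
    show "schwartz_approximable (?f n)" for n
    proof -
      have eq: "?f n = (\<lambda>x. \<Sum>y\<in>range (s n). y * indicator ((s n -` {y}) \<inter> ?B n) x)"
      proof
        fix x
        have "(\<Sum>y\<in>range (s n). y * indicator ((s n -` {y}) \<inter> ?B n) x)
            = (\<Sum>y\<in>range (s n). if y = s n x then y * indicator (?B n) x else 0)"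
          by (intro sum.cong) (auto simp: indicator_def)
        also have "\<dots> = ?f n x"
          using simple_functionD(1)[OF s(1)[of n]] by (subst sum.delta) auto
        finally show "?f n x = (\<Sum>y\<in>range (s n). y * indicator ((s n -` {y}) \<inter> ?B n) x)" ..
      qed
      show ?thesis
        unfolding eq using simple_functionD[OF s(1)[of n]]
        by (intro schwartz_approximable_sum schwartz_approximable_cmult schwartz_approximable_indicator) auto
    qed
    show "(\<lambda>n. ?f n x) \<longlonglongrightarrow> f x" for x
    proof (rule Lim_transform_eventually[OF s(2)])
      obtain N where N: "norm x < real N" using reals_Archimedean2 by blast
      obtain p q t where x: "x = (p, q, t)" by (cases x)
      have n: "\<bar>p\<bar> \<le> norm x" "\<bar>q\<bar> \<le> norm x" "\<bar>t\<bar> \<le> norm x"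
        using norm_fst_le[of p "(q, t)"] norm_snd_le[of "(q, t)" p] norm_fst_le[of q t] norm_snd_le[of t q]
        unfolding x by auto
      have "x \<in> ?B n" if "n \<ge> N" for n
        using n N that unfolding mem_box_heis by (auto simp: x)
      then show "\<forall>\<^sub>F n in sequentially. s n x = ?f n x"
        by (auto simp: eventually_sequentially intro!: exI[of _ N])
    qed
    show "(cmod (?f n x))\<^sup>2 \<le> 4 * (cmod (f x))\<^sup>2" for n x
    proof -
      have "cmod (?f n x) \<le> 2 * cmod (f x)"
        using s(3)[of n x] by (auto simp: indicator_def norm_mult)
      then have "(cmod (?f n x))\<^sup>2 \<le> (2 * cmod (f x))\<^sup>2"
        by (rule power_mono) simp
      then show ?thesis by simp
    qed
    show "integrable lborel (\<lambda>x. 4 * (cmod (f x))\<^sup>2)"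
      using L2_integrable[OF f] by simp
  qed
qed

lemma exists_nonzero_schwartz:
  obtains g :: "heis \<Rightarrow> complex" where "g \<in> schwartz" "0 < (LINT x|lborel. (cmod (g x))\<^sup>2)"
proof -
  have "rapidly_growing (bump_exponent 0 0 1)"
    by (rule rapidly_growing_bump_exponent) simp
  note r = poly_exp3_schwartz[OF this this this, of 1 1 1]
  define g where "g = poly_exp3 (bump_exponent 0 0 1, bump_exponent 0 0 1, bump_exponent 0 0 1) (1, 1, 1)"
  have g: "g \<in> schwartz" unfolding g_def by (rule r)
  have nz: "g x \<noteq> 0" for x by (simp add: g_def poly_exp3_def poly_exp_def)
  have i: "integrable lborel (\<lambda>x. (cmod (g x))\<^sup>2)"
    by (rule L2_integrable[OF schwartz_L2[OF g]])
  have "(LINT x|lborel. (cmod (g x))\<^sup>2) \<noteq> 0"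
  proof
    assume "(LINT x|lborel. (cmod (g x))\<^sup>2) = 0"
    then have "AE x in lborel. (cmod (g x))\<^sup>2 = 0"
      using integral_nonneg_eq_0_iff_AE[OF i] by simp
    then have "AE x in (lborel :: heis measure). False"
      using nz by simp
    then show False
      by (simp add: eventually_False ae_filter_eq_bot_iff)
  qed
  moreover have "0 \<le> (LINT x|lborel. (cmod (g x))\<^sup>2)" by simp
  ultimately show ?thesis using g that by (metis order_le_less)
qed

lemma schwartz_dense_sequence:
  fixes f :: "heis \<Rightarrow> complex"
  assumes f: "f \<in> L2 lborel"
  obtains g where "\<And>n. g n \<in> schwartz" "(\<lambda>n. LINT x|lborel. (cmod (f x - g n x))\<^sup>2) \<longlonglongrightarrow> 0"
proof -
  have "\<exists>g\<in>schwartz. (LINT x|lborel. (cmod (f x - g x))\<^sup>2) < 1 / real (Suc n)" for n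
    using schwartz_dense_L2[OF f] unfolding schwartz_approximable_def by simp
  then obtain g where g: "g n \<in> schwartz" "(LINT x|lborel. (cmod (f x - g n x))\<^sup>2) < 1 / real (Suc n)" for n
    by metis
  have "(\<lambda>n. LINT x|lborel. (cmod (f x - g n x))\<^sup>2) \<longlonglongrightarrow> 0"
  proof (rule tendsto_sandwich[OF _ _ tendsto_const LIMSEQ_Suc[OF lim_1_over_n]])
    show "\<forall>\<^sub>F n in sequentially. (LINT x|lborel. (cmod (f x - g n x))\<^sup>2) \<le> 1 / of_nat (Suc n)"
      using g(2) by (intro always_eventually allI less_imp_le)
  qed simp
  with g(1) show ?thesis by (rule that)
qed

section \<open>Square integrable functions: inner products and limits\<close>

lemma L2_mult_cnj_integrable:
  assumes f: "f \<in> L2 M" and g: "g \<in> L2 M"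
  shows "integrable M (\<lambda>x. f x * cnj (g x))"
proof (rule Bochner_Integration.integrable_bound)
  show "integrable M (\<lambda>x. (cmod (f x))\<^sup>2 + (cmod (g x))\<^sup>2)"
    using L2_integrable[OF f] L2_integrable[OF g] by simp
  show "(\<lambda>x. f x * cnj (g x)) \<in> borel_measurable M"
    using L2_measurable[OF f] L2_measurable[OF g] by measurable
  show "AE x in M. norm (f x * cnj (g x)) \<le> norm ((cmod (f x))\<^sup>2 + (cmod (g x))\<^sup>2)"
  proof (rule AE_I2)
    fix x
    have "0 \<le> (cmod (f x) - cmod (g x))\<^sup>2" by simp
    then have "2 * (cmod (f x) * cmod (g x)) \<le> (cmod (f x))\<^sup>2 + (cmod (g x))\<^sup>2"
      by (simp add: power2_diff)
    moreover have "0 \<le> cmod (f x) * cmod (g x)" by simp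
    ultimately have "cmod (f x) * cmod (g x) \<le> (cmod (f x))\<^sup>2 + (cmod (g x))\<^sup>2"
      by linarith
    then show "norm (f x * cnj (g x)) \<le> norm ((cmod (f x))\<^sup>2 + (cmod (g x))\<^sup>2)"
      by (simp add: norm_mult)
  qed
qed

text \<open>Cauchy--Schwarz in a form without square roots: the arithmetic--geometric mean inequality, with
  a free parameter to be optimised.\<close>

lemma cmod_integral_mult_cnj_le:
  assumes f: "f \<in> L2 M" and g: "g \<in> L2 M" and d: "0 < d"
  shows "2 * cmod (LINT x|M. f x * cnj (g x))
    \<le> (LINT x|M. (cmod (f x))\<^sup>2) / d + d * (LINT x|M. (cmod (g x))\<^sup>2)"
proof -
  have "cmod (LINT x|M. f x * cnj (g x)) \<le> (LINT x|M. cmod (f x * cnj (g x)))"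
    by (rule integral_norm_bound)
  also have "\<dots> \<le> (LINT x|M. ((cmod (f x))\<^sup>2 / d + d * (cmod (g x))\<^sup>2) / 2)"
  proof (rule integral_mono)
    show "integrable M (\<lambda>x. cmod (f x * cnj (g x)))"
      using L2_mult_cnj_integrable[OF f g] by (rule integrable_norm)
    show "integrable M (\<lambda>x. ((cmod (f x))\<^sup>2 / d + d * (cmod (g x))\<^sup>2) / 2)"
      using L2_integrable[OF f] L2_integrable[OF g] by simp
    fix x
    have "0 \<le> (cmod (f x) - d * cmod (g x))\<^sup>2 / d"
      using d by simp
    also have "\<dots> = (cmod (f x))\<^sup>2 / d + d * (cmod (g x))\<^sup>2 - 2 * (cmod (f x) * cmod (g x))"
      using d by (simp add: power2_eq_square field_simps)
    finally show "cmod (f x * cnj (g x)) \<le> ((cmod (f x))\<^sup>2 / d + d * (cmod (g x))\<^sup>2) / 2"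
      by (simp add: norm_mult)
  qed
  also have "\<dots> = ((LINT x|M. (cmod (f x))\<^sup>2) / d + d * (LINT x|M. (cmod (g x))\<^sup>2)) / 2"
    using L2_integrable[OF f] L2_integrable[OF g] by simp
  finally show ?thesis by simp
qed

lemma L2_convergence_imp_weak:
  assumes f: "\<And>n. f n \<in> L2 M" and g: "g \<in> L2 M"
    and lim: "(\<lambda>n. LINT x|M. (cmod (f n x))\<^sup>2) \<longlonglongrightarrow> 0"
  shows "(\<lambda>n. LINT x|M. f n x * cnj (g x)) \<longlonglongrightarrow> 0"
proof (rule tendsto_norm_zero_cancel, rule tendsto_sandwich[OF _ _ tendsto_const])
  let ?F = "\<lambda>n. LINT x|M. (cmod (f n x))\<^sup>2" and ?G = "LINT x|M. (cmod (g x))\<^sup>2"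
  \<comment> \<open>The optimal parameter is a multiple of \<open>sqrt (?F n)\<close>; the summand \<open>1 / Suc n\<close> keeps it positive if
    \<open>?F n = 0\<close>.\<close>
  let ?d = "\<lambda>n. sqrt (?F n) + 1 / real (Suc n)"
  have F: "0 \<le> ?F n" for n by simp
  have d: "0 < ?d n" for n
    using F[of n] by (intro add_nonneg_pos) (auto simp del: of_nat_Suc)
  show "\<forall>\<^sub>F n in sequentially. cmod (LINT x|M. f n x * cnj (g x)) \<le> (sqrt (?F n) + ?d n * ?G) / 2"
  proof (rule always_eventually, rule allI)
    fix n
    have "?F n / ?d n \<le> sqrt (?F n)"
    proof -
      have "?F n = sqrt (?F n) * sqrt (?F n)" using F[of n] by simp
      also have "\<dots> \<le> sqrt (?F n) * ?d n"
        using F[of n] by (intro mult_left_mono) auto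
      finally show ?thesis using d[of n] by (simp only: pos_divide_le_eq)
    qed
    then have "2 * cmod (LINT x|M. f n x * cnj (g x)) \<le> sqrt (?F n) + ?d n * ?G"
      by (rule order_trans[OF cmod_integral_mult_cnj_le[OF f g d] add_right_mono])
    then show "cmod (LINT x|M. f n x * cnj (g x)) \<le> (sqrt (?F n) + ?d n * ?G) / 2"
      by (simp only: pos_le_divide_eq[OF zero_less_numeral] mult.commute)
  qed
  have "(\<lambda>n. (sqrt (?F n) + ?d n * ?G) / 2) \<longlonglongrightarrow> (sqrt 0 + (sqrt 0 + 0) * ?G) / 2"
    by (intro tendsto_intros lim LIMSEQ_Suc[OF lim_1_over_n]) simp_all
  then show "(\<lambda>n. (sqrt (?F n) + ?d n * ?G) / 2) \<longlonglongrightarrow> 0" by simp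
qed simp

lemma complex_polarization:
  "4 * (z * cnj w) = of_real ((cmod (z + w))\<^sup>2) - of_real ((cmod (z + (- 1) * w))\<^sup>2)
     + \<i> * of_real ((cmod (z + \<i> * w))\<^sup>2) - \<i> * of_real ((cmod (z + (- \<i>) * w))\<^sup>2)"
  by (simp only: complex_norm_square) (simp add: algebra_simps)

lemma L2_polarization:
  assumes f: "f \<in> L2 M" and g: "g \<in> L2 M"
  defines "E \<equiv> \<lambda>c. complex_of_real (LINT x|M. (cmod (f x + c * g x))\<^sup>2)"
  shows "4 * (LINT x|M. f x * cnj (g x)) = E 1 - E (- 1) + \<i> * E \<i> - \<i> * E (- \<i>)"
proof -
  have i: "integrable M (\<lambda>x. complex_of_real ((cmod (f x + c * g x))\<^sup>2))" for c
    by (intro integrable_of_real L2_integrable L2_add L2_cmult f g)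
  have E: "E c = (LINT x|M. complex_of_real ((cmod (f x + c * g x))\<^sup>2))" for c
    unfolding E_def by (rule integral_complex_of_real[symmetric])
  have "4 * (LINT x|M. f x * cnj (g x)) = (LINT x|M. 4 * (f x * cnj (g x)))"
    by simp
  also have "\<dots> = (LINT x|M. complex_of_real ((cmod (f x + 1 * g x))\<^sup>2) - complex_of_real ((cmod (f x + - 1 * g x))\<^sup>2)
     + \<i> * complex_of_real ((cmod (f x + \<i> * g x))\<^sup>2) - \<i> * complex_of_real ((cmod (f x + - \<i> * g x))\<^sup>2))"
    by (simp only: complex_polarization mult_1_left)
  also have "\<dots> = E 1 - E (- 1) + \<i> * E \<i> - \<i> * E (- \<i>)"
    unfolding E using i[of 1] i[of "- 1"] i[of \<i>] i[of "- \<i>"]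
    by (simp only: Bochner_Integration.integral_diff Bochner_Integration.integral_add
        Bochner_Integration.integrable_diff Bochner_Integration.integrable_add
        integrable_mult_right integral_mult_right_zero)
  finally show ?thesis .
qed

text \<open>Expanding \<open>g = f - (f - g)\<close>, the mixed terms vanish in the limit by Cauchy--Schwarz.\<close>

lemma integral_cmod_square_tendsto:
  assumes g: "\<And>n. g n \<in> L2 M" and f: "f \<in> L2 M"
    and lim: "(\<lambda>n. LINT x|M. (cmod (f x - g n x))\<^sup>2) \<longlonglongrightarrow> 0"
  shows "(\<lambda>n. LINT x|M. (cmod (g n x))\<^sup>2) \<longlonglongrightarrow> (LINT x|M. (cmod (f x))\<^sup>2)"
proof -
  let ?F = "LINT x|M. (cmod (f x))\<^sup>2"
  have *: "of_real (LINT x|M. (cmod (g n x))\<^sup>2) = of_real ?F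
      - (LINT x|M. (f x - g n x) * cnj (f x)) - cnj (LINT x|M. (f x - g n x) * cnj (f x))
      + complex_of_real (LINT x|M. (cmod (f x - g n x))\<^sup>2)" for n
  proof -
    let ?h = "\<lambda>x. f x - g n x"
    have h: "?h \<in> L2 M" by (rule L2_diff[OF f g])
    have i: "integrable M (\<lambda>x. ?h x * cnj (f x))"
      by (rule L2_mult_cnj_integrable[OF h f])
    then have ic: "integrable M (\<lambda>x. cnj (?h x * cnj (f x)))"
      by (rule integrable_cnj)
    have if2: "integrable M (\<lambda>x. complex_of_real ((cmod (f x))\<^sup>2))"
      and ih2: "integrable M (\<lambda>x. complex_of_real ((cmod (?h x))\<^sup>2))"
      by (intro integrable_of_real L2_integrable f h)+
    have "complex_of_real (LINT x|M. (cmod (g n x))\<^sup>2) = (LINT x|M. complex_of_real ((cmod (g n x))\<^sup>2))"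
      by (rule integral_complex_of_real[symmetric])
    also have "\<dots> = (LINT x|M. complex_of_real ((cmod (f x))\<^sup>2) - ?h x * cnj (f x) - cnj (?h x * cnj (f x))
        + complex_of_real ((cmod (?h x))\<^sup>2))"
      by (rule Bochner_Integration.integral_cong[OF refl]) (simp only: complex_norm_square, simp add: algebra_simps)
    also have "\<dots> = (LINT x|M. complex_of_real ((cmod (f x))\<^sup>2)) - (LINT x|M. ?h x * cnj (f x))
        - (LINT x|M. cnj (?h x * cnj (f x))) + (LINT x|M. complex_of_real ((cmod (?h x))\<^sup>2))"
      using if2 ih2 i ic
      by (simp only: Bochner_Integration.integral_diff Bochner_Integration.integral_add
        Bochner_Integration.integrable_diff Bochner_Integration.integrable_add)
    finally show ?thesis
      by (simp only: integral_complex_of_real Bochner_Integration.integral_cnj)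
  qed
  have "(\<lambda>n. LINT x|M. (f x - g n x) * cnj (f x)) \<longlonglongrightarrow> 0"
    by (rule L2_convergence_imp_weak[OF L2_diff[OF f g] f lim])
  then have "(\<lambda>n. of_real (LINT x|M. (cmod (g n x))\<^sup>2)) \<longlonglongrightarrow> of_real ?F - 0 - cnj 0 + complex_of_real 0"
    unfolding * by (intro tendsto_intros lim)
  then show ?thesis
    by (simp only: diff_0_right complex_cnj_zero of_real_0 add_0_right tendsto_of_real_iff)
qed

section \<open>Truncated integrals and continuity of the wavelet transform\<close>

lemma space_haar_G: "space haar_G = UNIV \<times> {0<..}"
  by (simp add: haar_G_def space_restrict_space)

lemma haar_G_iterated_integral:
  fixes h :: "heis \<times> real \<Rightarrow> real"
  assumes [measurable]: "h \<in> borel_measurable borel" and h: "integrable haar_G h"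
  shows "(LINT x|haar_G. h x) = (LINT \<omega>|lborel. (LINT a:{0<..}|lborel. h (\<omega>, a) * (1 / a ^ 5)))"
proof -
  have "integrable lborel (\<lambda>x. haar_weight x *\<^sub>R h x)"
    using h by (simp add: integrable_haar_G)
  then have "(LINT x|haar_G. h x) = (LINT \<omega>|lborel. LINT a|lborel. haar_weight (\<omega>, a) *\<^sub>R h (\<omega>, a))"
    by (simp only: integral_haar_G[OF assms(1)]) (rule lebesgue_integral_lborel_prod(1))
  then show ?thesis
    by (simp add: set_lebesgue_integral_def haar_weight_def mult.commute)
qed

text \<open>The convergence holds along the two-parameter filter because the error for \<open>(\<epsilon>, A)\<close> is at most
  the integral of \<open>norm \<circ> h\<close> over the complement of any smaller truncation, and these tails tend to 0 along a
  sequence by dominated convergence.\<close>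

lemma truncated_integral_tendsto:
  fixes h :: "heis \<times> real \<Rightarrow> complex"
  assumes h: "integrable haar_G h"
  shows "((\<lambda>(\<epsilon>, A). LINT y|haar_G. indicator {\<epsilon>..A} (snd y) *\<^sub>R h y) \<longlongrightarrow> (LINT y|haar_G. h y))
    (at_right 0 \<times>\<^sub>F at_top)"
proof (rule tendstoI)
  have snd_m [measurable]: "snd \<in> borel_measurable haar_G"
  proof (rule measurable_haar_G)
    show "(snd :: heis \<times> real \<Rightarrow> real) \<in> borel_measurable borel"
      by (intro borel_measurable_continuous_onI continuous_intros)
  qed
  have [measurable]: "h \<in> borel_measurable haar_G"
    using borel_measurable_integrable[OF h] .
  let ?S = "\<lambda>n. {1 / real (Suc n)..real (Suc n)}"
  let ?T = "\<lambda>n y. (1 - indicator (?S n) (snd y)) * norm (h y) :: real"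
  have nh: "integrable haar_G (\<lambda>y. norm (h y))"
    using h by (rule integrable_norm)
  have trunc: "integrable haar_G (\<lambda>y. indicator {\<epsilon>..A} (snd y) *\<^sub>R h y)" for \<epsilon> A
    by (rule Bochner_Integration.integrable_bound[OF h]) (auto intro!: AE_I2 simp: indicator_def)
  have Tint: "integrable haar_G (?T n)" for n
    by (rule Bochner_Integration.integrable_bound[OF nh]) (auto intro!: AE_I2 simp: indicator_def)
  have "(\<lambda>n. LINT y|haar_G. ?T n y) \<longlonglongrightarrow> (LINT y|haar_G. (0 :: real))"
  proof (rule integral_dominated_convergence[where w = "\<lambda>y. norm (h y)"])
    show "AE y in haar_G. (\<lambda>n. ?T n y) \<longlonglongrightarrow> 0"
    proof (rule AE_I2)
      fix y assume "y \<in> space haar_G"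
      then have a: "0 < snd y" by (auto simp: space_haar_G)
      obtain N where N: "snd y < real N" "1 / snd y < real N"
        using reals_Archimedean2[of "max (snd y) (1 / snd y)"] by auto
      have "?T n y = 0" if "n \<ge> N" for n
      proof -
        have "1 / snd y < real (Suc n)" "snd y < real (Suc n)" using N that by auto
        then show ?thesis using a by (simp add: field_simps del: of_nat_Suc)
      qed
      then show "(\<lambda>n. ?T n y) \<longlonglongrightarrow> 0"
        by (intro tendsto_eventually) (auto simp: eventually_sequentially)
    qed
  qed (use nh in \<open>auto simp: indicator_def intro!: AE_I2\<close>)
  then have T: "(\<lambda>n. LINT y|haar_G. ?T n y) \<longlonglongrightarrow> 0" by simp
  fix e :: real assume e: "e > 0"
  obtain n where n: "(LINT y|haar_G. ?T n y) < e"
    using order_tendstoD(2)[OF T e] by (auto simp: eventually_sequentially)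
  have "\<forall>\<^sub>F \<epsilon> in at_right (0 :: real). \<epsilon> < 1 / real (Suc n)"
    by (rule order_tendstoD(2)[OF tendsto_ident_at]) simp
  from eventually_prodI[OF this eventually_gt_at_top[of "real (Suc n)"]]
  show "\<forall>\<^sub>F p in at_right 0 \<times>\<^sub>F at_top. dist (case p of (\<epsilon>, A) \<Rightarrow> LINT y|haar_G. indicator {\<epsilon>..A} (snd y) *\<^sub>R h y)
      (LINT y|haar_G. h y) < e"
  proof eventually_elim
    case (elim p)
    obtain \<epsilon> A where p: "p = (\<epsilon>, A)" by (cases p)
    have "dist (LINT y|haar_G. indicator {\<epsilon>..A} (snd y) *\<^sub>R h y) (LINT y|haar_G. h y)
        = norm (LINT y|haar_G. indicator {\<epsilon>..A} (snd y) *\<^sub>R h y - h y)"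
      unfolding dist_norm using trunc h by (subst Bochner_Integration.integral_diff) auto
    also have "\<dots> \<le> (LINT y|haar_G. norm (indicator {\<epsilon>..A} (snd y) *\<^sub>R h y - h y))"
      by (rule integral_norm_bound)
    also have "\<dots> \<le> (LINT y|haar_G. ?T n y)"
      using elim by (intro integral_mono integrable_norm Bochner_Integration.integrable_diff trunc h Tint)
        (auto simp: indicator_def p)
    finally show ?case using n by (simp add: p)
  qed
qed

lemma haar_truncation:
  fixes h :: "heis \<times> real \<Rightarrow> complex"
  assumes [measurable]: "h \<in> borel_measurable borel"
  shows "(LINT y|haar_G. indicator {\<epsilon>..A} (snd y) *\<^sub>R h y)
    = (LINT y|lborel. (indicator {\<epsilon>..A} (snd y) * haar_weight y) *\<^sub>R h y)"
proof -
  have "(\<lambda>y :: heis \<times> real. indicator {\<epsilon>..A} (snd y) :: real) \<in> borel_measurable (borel \<Otimes>\<^sub>M borel)"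
    by measurable
  then have [measurable]: "(\<lambda>y :: heis \<times> real. indicator {\<epsilon>..A} (snd y) :: real) \<in> borel_measurable borel"
    by (simp add: borel_prod)
  show ?thesis by (subst integral_haar_G) (simp_all add: mult.commute)
qed

context integrable_wavelet
begin

lemma quasi_regular_L2:
  assumes "snd x > 0"
  shows "quasi_regular x \<phi> \<in> L2 lborel"
proof -
  obtain \<omega> a where x: "x = (\<omega>, a)" by (cases x)
  have a: "a > 0" using assms x by simp
  have eq: "quasi_regular x \<phi> = (\<lambda>v. of_real (a\<^sup>2) * dilate a \<phi> (heis_mult (heis_inv \<omega>) v))"
    using a by (auto simp: x dilate_def scaleR_conv_of_real fun_eq_iff field_simps power2_eq_square power4_eq_xxxx)
  have m [measurable]: "(\<lambda>v. dilate a \<phi> (heis_mult (heis_inv \<omega>) v)) \<in> borel_measurable lborel"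
    by measurable
  have "integrable lborel (\<lambda>v. dilate a \<phi> (heis_mult (heis_inv \<omega>) v))"
  proof (rule integrableI_bounded[OF m])
    have "(\<integral>\<^sup>+v. norm (dilate a \<phi> (heis_mult (heis_inv \<omega>) v)) \<partial>lborel) = (\<integral>\<^sup>+v. norm (dilate a \<phi> v) \<partial>lborel)"
      by (rule nn_integral_heis_mult_left[where f = "\<lambda>z. ennreal (norm (dilate a \<phi> z))"]) measurable
    also have "\<dots> = (\<integral>\<^sup>+v. norm (\<phi> v) \<partial>lborel)"
      using a by (intro nn_integral_dilate) auto
    also have "\<dots> < \<infinity>"
      using integrable_wavelet by (simp add: integrable_iff_bounded)
    finally show "(\<integral>\<^sup>+v. norm (dilate a \<phi> (heis_mult (heis_inv \<omega>) v)) \<partial>lborel) < \<infinity>" .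
  qed
  then have "integrable lborel (\<lambda>v. norm (dilate a \<phi> (heis_mult (heis_inv \<omega>) v)) * (M / a ^ 4))"
    by (intro integrable_mult_left integrable_norm)
  then have "(\<lambda>v. dilate a \<phi> (heis_mult (heis_inv \<omega>) v)) \<in> L2 lborel"
    by (rule L2_dominated[OF m]) (simp only: power2_eq_square mult_left_mono[OF dilate_bounded norm_ge_zero])
  then show ?thesis
    unfolding eq by (rule L2_cmult)
qed

text \<open>The integrals exist by \<open>quasi_regular_L2\<close>, for \<open>a > 0\<close> and thus on all of \<open>space haar_G\<close>.\<close>

lemma wavelet_transform_add_cmult:
  assumes f: "f \<in> L2 lborel" and g: "g \<in> L2 lborel" and x: "snd x > 0"
  shows "wavelet_transform \<phi> (\<lambda>v. f v + c * g v) x = wavelet_transform \<phi> f x + c * wavelet_transform \<phi> g x"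
  using L2_mult_cnj_integrable[OF f quasi_regular_L2[OF x]] L2_mult_cnj_integrable[OF g quasi_regular_L2[OF x]]
  unfolding wavelet_transform_def L2_inner_def by (simp add: ring_distribs mult.assoc)

text \<open>For a fixed point of \<open>G\<close> the transform is an inner product with a fixed element of \<open>L\<^sup>2\<close>, hence
  \<open>L\<^sup>2\<close>-continuous. This pointwise convergence is what Fatou's lemma needs later.\<close>

lemma wavelet_transform_tendsto:
  assumes f: "\<And>n. f n \<in> L2 lborel" and l: "l \<in> L2 lborel" and x: "snd x > 0"
    and lim: "(\<lambda>n. LINT v|lborel. (cmod (l v - f n v))\<^sup>2) \<longlonglongrightarrow> 0"
  shows "(\<lambda>n. wavelet_transform \<phi> (f n) x) \<longlonglongrightarrow> wavelet_transform \<phi> l x"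
proof -
  have "(\<lambda>n. LINT v|lborel. (l v - f n v) * cnj (quasi_regular x \<phi> v)) \<longlonglongrightarrow> 0"
    by (rule L2_convergence_imp_weak[OF L2_diff[OF l f] quasi_regular_L2[OF x] lim])
  also have "(\<lambda>n. LINT v|lborel. (l v - f n v) * cnj (quasi_regular x \<phi> v))
      = (\<lambda>n. wavelet_transform \<phi> l x - wavelet_transform \<phi> (f n) x)"
    using L2_mult_cnj_integrable[OF l quasi_regular_L2[OF x]] L2_mult_cnj_integrable[OF f quasi_regular_L2[OF x]]
    unfolding wavelet_transform_def L2_inner_def by (simp add: left_diff_distrib)
  finally have "(\<lambda>n. wavelet_transform \<phi> l x - (wavelet_transform \<phi> l x - wavelet_transform \<phi> (f n) x))
      \<longlonglongrightarrow> wavelet_transform \<phi> l x - 0"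
    by (intro tendsto_intros)
  then show ?thesis by simp
qed

end

section \<open>Admissibility and the Calderon condition\<close>

context integrable_wavelet
begin

lemma calderon_kernel_pairing_haar:
  assumes \<epsilon>: "0 < \<epsilon>" and g: "integrable lborel g" and \<psi>: "integrable lborel \<psi>"
  shows "(LINT x|lborel. heis_conv g (calderon_kernel \<phi> \<epsilon> A) x * \<psi> x)
    = (LINT y|haar_G. indicator {\<epsilon>..A} (snd y) *\<^sub>R
        (wavelet_transform \<phi> g y * cnj (wavelet_transform \<phi> (\<lambda>x. cnj (\<psi> x)) y)))"
proof -
  have [measurable]: "g \<in> borel_measurable borel" "\<psi> \<in> borel_measurable borel"
    using borel_measurable_integrable[OF g] borel_measurable_integrable[OF \<psi>] by simp_all
  show ?thesis
    unfolding calderon_kernel_pairing[OF assms] by (rule haar_truncation[symmetric]) measurable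
qed

lemma wavelet_transform_measurable_haar_G:
  assumes "f \<in> L2 lborel"
  shows "wavelet_transform \<phi> f \<in> borel_measurable haar_G"
  using L2_measurable[OF assms] by (intro measurable_haar_G borel_measurable_wavelet_transform) auto

text \<open>The squared norm of the wavelet transform in \<open>L\<^sup>2(G)\<close>, with extended values so that it makes sense
  before the transform is known to be square integrable.\<close>

definition energy :: "(heis \<Rightarrow> complex) \<Rightarrow> ennreal" where
  "energy f = (\<integral>\<^sup>+y. ennreal ((cmod (wavelet_transform \<phi> f y))\<^sup>2) \<partial>haar_G)"

lemma L2_haar_G_of_energy:
  assumes f: "f \<in> L2 lborel" and e: "energy f = ennreal r" "0 \<le> r"
  shows "wavelet_transform \<phi> f \<in> L2 haar_G"
    and "(LINT y|haar_G. (cmod (wavelet_transform \<phi> f y))\<^sup>2) = r"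
proof -
  note [measurable] = wavelet_transform_measurable_haar_G[OF f]
  have "integrable haar_G (\<lambda>y. (cmod (wavelet_transform \<phi> f y))\<^sup>2)"
    using e by (intro integrableI_nonneg) (auto simp: energy_def)
  then show "wavelet_transform \<phi> f \<in> L2 haar_G"
    by (simp add: L2_def)
  show "(LINT y|haar_G. (cmod (wavelet_transform \<phi> f y))\<^sup>2) = r"
    using e by (subst integral_eq_nn_integral) (auto simp: energy_def)
qed

text \<open>The choice \<open>\<psi> = cnj g\<close> makes the pairing a truncated energy. Along \<open>\<epsilon> = 1 / n\<close>, \<open>A = n\<close> these
  increase to the full energy, so the Calderon limit identifies it. As the energies are real and
  nonnegative, so is the limit \<open>c * (LINT x|lborel. (cmod (g x))\<^sup>2)\<close>.\<close>

lemma energy_of_calderon_limit: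
  assumes g: "g \<in> schwartz"
    and lim: "tempered_tendsto (\<lambda>(\<epsilon>, A). heis_conv g (calderon_kernel \<phi> \<epsilon> A)) (\<lambda>\<omega>. c * g \<omega>)
      (at_right 0 \<times>\<^sub>F at_top)"
  shows "energy g = ennreal (Re c * (LINT x|lborel. (cmod (g x))\<^sup>2))"
    and "Im c * (LINT x|lborel. (cmod (g x))\<^sup>2) = 0"
    and "0 \<le> Re c * (LINT x|lborel. (cmod (g x))\<^sup>2)"
proof -
  let ?N = "LINT x|lborel. (cmod (g x))\<^sup>2"
  let ?e = "\<lambda>n. 1 / real (Suc n)" and ?A = "\<lambda>n. real (Suc n)"
  let ?V = "\<lambda>y. (cmod (wavelet_transform \<phi> g y))\<^sup>2"
  let ?R = "\<lambda>n y. (indicator {?e n..?A n} (snd y) * haar_weight y) * ?V y"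
  have gi: "integrable lborel g" and ci: "integrable lborel (\<lambda>x. cnj (g x))"
    using schwartz_integrable[OF g] by simp_all
  have [measurable]: "g \<in> borel_measurable borel"
    using schwartz_borel_measurable[OF g] .
  have cR: "(indicator {?e n..?A n} (snd y) * haar_weight y) *\<^sub>R
      (wavelet_transform \<phi> g y * cnj (wavelet_transform \<phi> (\<lambda>x. cnj (cnj (g x))) y)) = complex_of_real (?R n y)" for n y
    by (simp only: complex_cnj_cnj complex_norm_square[symmetric] scaleR_conv_of_real of_real_mult)
  have e: "0 < ?e n" for n by simp
  have Ri: "integrable lborel (?R n)" for n
    using integrable_truncated_wavelet_product[OF e[of n] gi ci, of "?A n"]
    unfolding cR complex_of_real_integrable_eq .
  have pair: "(LINT x|lborel. heis_conv g (calderon_kernel \<phi> (?e n) (?A n)) x * cnj (g x))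
      = complex_of_real (LINT y|lborel. ?R n y)" for n
    unfolding calderon_kernel_pairing[OF e gi ci] cR by (rule integral_complex_of_real)
  have "((\<lambda>i. LINT x|lborel. (case i of (\<epsilon>, A) \<Rightarrow> heis_conv g (calderon_kernel \<phi> \<epsilon> A)) x * cnj (g x)) \<longlongrightarrow>
      (LINT x|lborel. (c * g x) * cnj (g x))) (at_right 0 \<times>\<^sub>F at_top)"
    using bspec[OF lim[unfolded tempered_tendsto_def] schwartz_cnj[OF g]] by simp
  moreover have "filterlim (\<lambda>n. (?e n, ?A n)) (at_right 0 \<times>\<^sub>F at_top) sequentially"
  proof (rule filterlim_Pair)
    show "filterlim ?e (at_right 0) sequentially"
      unfolding filterlim_at using LIMSEQ_Suc[OF lim_1_over_n] by auto
    show "filterlim ?A at_top sequentially"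
      by (rule filterlim_compose[OF filterlim_real_sequentially filterlim_Suc])
  qed
  ultimately have "(\<lambda>n. LINT x|lborel. heis_conv g (calderon_kernel \<phi> (?e n) (?A n)) x * cnj (g x)) \<longlonglongrightarrow>
      (LINT x|lborel. (c * g x) * cnj (g x))"
    using filterlim_compose by fastforce
  also have "(LINT x|lborel. (c * g x) * cnj (g x)) = c * complex_of_real ?N"
    by (simp only: mult.assoc integral_mult_right_zero complex_norm_square[symmetric] integral_complex_of_real)
  finally have L: "(\<lambda>n. complex_of_real (LINT y|lborel. ?R n y)) \<longlonglongrightarrow> c * complex_of_real ?N"
    unfolding pair .
  from tendsto_Re[OF L] have Re: "(\<lambda>n. LINT y|lborel. ?R n y) \<longlonglongrightarrow> Re c * ?N" by simp
  from tendsto_Im[OF L] have "(\<lambda>n. 0) \<longlonglongrightarrow> Im c * ?N" by simp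
  then show "Im c * ?N = 0"
    by (simp add: LIMSEQ_const_iff)
  show "0 \<le> Re c * ?N"
    by (rule LIMSEQ_le_const[OF Re]) (auto intro!: exI[of _ 0] Bochner_Integration.integral_nonneg)
  have "(\<lambda>n. \<integral>\<^sup>+y. ennreal (?R n y) \<partial>lborel) \<longlonglongrightarrow> (\<integral>\<^sup>+y. ennreal (haar_weight y * ?V y) \<partial>lborel)"
  proof (rule nn_integral_LIMSEQ)
    show "incseq (\<lambda>n y. ennreal (?R n y))"
    proof (intro incseq_SucI le_funI ennreal_leI mult_right_mono)
      fix n and y :: "heis \<times> real"
      have "?e (Suc n) \<le> ?e n" by (simp add: field_simps)
      then show "indicator {?e n..?A n} (snd y) \<le> (indicator {?e (Suc n)..?A (Suc n)} (snd y) :: real)"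
        by (auto simp: indicator_def simp del: of_nat_Suc)
    qed auto
    show "(\<lambda>y. ennreal (?R n y)) \<in> borel_measurable lborel" for n
      using borel_measurable_integrable[OF Ri] by simp
    show "(\<lambda>n. ennreal (?R n y)) \<longlonglongrightarrow> ennreal (haar_weight y * ?V y)" for y
    proof (cases "0 < snd y")
      case True
      obtain N where N: "snd y < real N" "1 / snd y < real N"
        using reals_Archimedean2[of "max (snd y) (1 / snd y)"] by auto
      have "?R n y = haar_weight y * ?V y" if "n \<ge> N" for n
      proof -
        have "1 / snd y < real (Suc n)" "snd y < real (Suc n)" using N that by auto
        then show ?thesis using True by (simp add: field_simps del: of_nat_Suc)
      qed
      then show ?thesis
        by (intro tendsto_eventually) (auto simp: eventually_sequentially)
    next
      case False
      then show ?thesis by (simp add: haar_weight_def)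
    qed
  qed
  moreover have "(\<integral>\<^sup>+y. ennreal (haar_weight y * ?V y) \<partial>lborel) = energy g"
    unfolding energy_def by (subst nn_integral_haar_G) (simp_all add: ennreal_mult)
  moreover have "(\<integral>\<^sup>+y. ennreal (?R n y) \<partial>lborel) = ennreal (LINT y|lborel. ?R n y)" for n
    by (rule nn_integral_eq_integral[OF Ri]) (auto intro!: AE_I2)
  moreover have "(\<lambda>n. ennreal (LINT y|lborel. ?R n y)) \<longlonglongrightarrow> ennreal (Re c * ?N)"
    by (rule tendsto_ennrealI[OF Re])
  ultimately show "energy g = ennreal (Re c * ?N)"
    using LIMSEQ_unique by fastforce
qed

lemma energy_add_le:
  assumes f: "f \<in> L2 lborel" and g: "g \<in> L2 lborel" and d: "0 < d"
  shows "energy (\<lambda>x. f x + g x) \<le> ennreal (1 + d) * energy f + ennreal (1 + 1 / d) * energy g"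
proof -
  note [measurable] = wavelet_transform_measurable_haar_G[OF f] wavelet_transform_measurable_haar_G[OF g]
  have "energy (\<lambda>x. f x + g x) \<le> (\<integral>\<^sup>+y. ennreal (1 + d) * ennreal ((cmod (wavelet_transform \<phi> f y))\<^sup>2)
      + ennreal (1 + 1 / d) * ennreal ((cmod (wavelet_transform \<phi> g y))\<^sup>2) \<partial>haar_G)"
    unfolding energy_def
  proof (rule nn_integral_mono)
    fix y assume "y \<in> space haar_G"
    then have "0 < snd y" by (auto simp: space_haar_G)
    then have "wavelet_transform \<phi> (\<lambda>x. f x + g x) y = wavelet_transform \<phi> f y + wavelet_transform \<phi> g y"
      using wavelet_transform_add_cmult[OF f g, of y 1] by simp
    then show "ennreal ((cmod (wavelet_transform \<phi> (\<lambda>x. f x + g x) y))\<^sup>2)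
      \<le> ennreal (1 + d) * ennreal ((cmod (wavelet_transform \<phi> f y))\<^sup>2)
      + ennreal (1 + 1 / d) * ennreal ((cmod (wavelet_transform \<phi> g y))\<^sup>2)"
      using d cmod_add_square_le[OF d, of "wavelet_transform \<phi> f y" "wavelet_transform \<phi> g y"]
      by (simp add: ennreal_mult[symmetric] ennreal_plus[symmetric] del: ennreal_plus)
  qed
  also have "\<dots> = ennreal (1 + d) * energy f + ennreal (1 + 1 / d) * energy g"
    unfolding energy_def by (subst nn_integral_add) (simp_all add: nn_integral_cmult)
  finally show ?thesis .
qed

text \<open>The upper bound passes from Schwartz functions \<open>g\<close> to their limit \<open>f\<close> by Fatou's lemma. Once it
  holds on all of \<open>L\<^sup>2\<close>, it applies to \<open>g - f\<close> and shows that the energy of this difference tends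
  to 0; by \<open>energy_add_le\<close> the energy of \<open>f\<close> is then at least the limit of those of \<open>g\<close>, up to the
  factor \<open>1 + d\<close>.\<close>

lemma energy_extends_to_L2:
  assumes C: "0 \<le> C"
    and S: "\<And>g. g \<in> schwartz \<Longrightarrow> energy g = ennreal (C * (LINT x|lborel. (cmod (g x))\<^sup>2))"
    and f: "f \<in> L2 lborel"
  shows "energy f = ennreal (C * (LINT x|lborel. (cmod (f x))\<^sup>2))"
proof -
  have le: "energy l \<le> ennreal (C * (LINT x|lborel. (cmod (l x))\<^sup>2))" if l: "l \<in> L2 lborel" for l
  proof -
    obtain g where g: "\<And>n. g n \<in> schwartz" "(\<lambda>n. LINT x|lborel. (cmod (l x - g n x))\<^sup>2) \<longlonglongrightarrow> 0"
      using schwartz_dense_sequence[OF l] by blast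
    have gL: "g n \<in> L2 lborel" for n by (rule schwartz_L2[OF g(1)])
    note [measurable] = wavelet_transform_measurable_haar_G[OF gL]
    have "energy l = (\<integral>\<^sup>+y. liminf (\<lambda>n. ennreal ((cmod (wavelet_transform \<phi> (g n) y))\<^sup>2)) \<partial>haar_G)"
      unfolding energy_def
    proof (rule nn_integral_cong)
      fix y assume "y \<in> space haar_G"
      then have "0 < snd y" by (auto simp: space_haar_G)
      then have "(\<lambda>n. wavelet_transform \<phi> (g n) y) \<longlonglongrightarrow> wavelet_transform \<phi> l y"
        by (rule wavelet_transform_tendsto[OF gL l _ g(2)])
      then have "(\<lambda>n. ennreal ((cmod (wavelet_transform \<phi> (g n) y))\<^sup>2)) \<longlonglongrightarrow> ennreal ((cmod (wavelet_transform \<phi> l y))\<^sup>2)"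
        by (intro tendsto_ennrealI tendsto_power tendsto_norm)
      then show "ennreal ((cmod (wavelet_transform \<phi> l y))\<^sup>2) = liminf (\<lambda>n. ennreal ((cmod (wavelet_transform \<phi> (g n) y))\<^sup>2))"
        by (rule lim_imp_Liminf[OF sequentially_bot, symmetric])
    qed
    also have "\<dots> \<le> liminf (\<lambda>n. energy (g n))"
      unfolding energy_def by (rule nn_integral_liminf) measurable
    also have "\<dots> = ennreal (C * (LINT x|lborel. (cmod (l x))\<^sup>2))"
      unfolding S[OF g(1)]
      by (intro lim_imp_Liminf tendsto_ennrealI tendsto_mult tendsto_const integral_cmod_square_tendsto gL l g(2)) simp
    finally show ?thesis .
  qed
  let ?N = "LINT x|lborel. (cmod (f x))\<^sup>2"
  obtain r where r: "energy f = ennreal r" "0 \<le> r" "r \<le> C * ?N"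
    using le[OF f] C by (cases "energy f") (auto simp: top_unique)
  obtain g where g: "\<And>n. g n \<in> schwartz" "(\<lambda>n. LINT x|lborel. (cmod (f x - g n x))\<^sup>2) \<longlonglongrightarrow> 0"
    using schwartz_dense_sequence[OF f] by blast
  have gL: "g n \<in> L2 lborel" for n by (rule schwartz_L2[OF g(1)])
  have lower: "C * ?N \<le> (1 + d) * r" if d: "0 < d" for d
  proof (rule LIMSEQ_le)
    show "(\<lambda>n. C * (LINT x|lborel. (cmod (g n x))\<^sup>2)) \<longlonglongrightarrow> C * ?N"
      by (intro tendsto_mult tendsto_const integral_cmod_square_tendsto gL f g(2))
    have "(\<lambda>n. (1 + d) * r + (1 + 1 / d) * (C * (LINT x|lborel. (cmod (f x - g n x))\<^sup>2)))
        \<longlonglongrightarrow> (1 + d) * r + (1 + 1 / d) * (C * 0)"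
      by (intro tendsto_intros g(2))
    then show "(\<lambda>n. (1 + d) * r + (1 + 1 / d) * (C * (LINT x|lborel. (cmod (f x - g n x))\<^sup>2))) \<longlonglongrightarrow> (1 + d) * r"
      by simp
    show "\<exists>N. \<forall>n\<ge>N. C * (LINT x|lborel. (cmod (g n x))\<^sup>2)
        \<le> (1 + d) * r + (1 + 1 / d) * (C * (LINT x|lborel. (cmod (f x - g n x))\<^sup>2))"
    proof (intro exI allI impI)
      fix n
      let ?h = "\<lambda>x. g n x - f x"
      have h: "?h \<in> L2 lborel" by (rule L2_diff[OF gL f])
      have hN: "(LINT x|lborel. (cmod (?h x))\<^sup>2) = (LINT x|lborel. (cmod (f x - g n x))\<^sup>2)"
        by (simp add: norm_minus_commute)
      have "ennreal (C * (LINT x|lborel. (cmod (g n x))\<^sup>2)) = energy (\<lambda>x. f x + ?h x)"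
        using S[OF g(1)[of n]] by simp
      also have "\<dots> \<le> ennreal (1 + d) * energy f + ennreal (1 + 1 / d) * energy ?h"
        by (rule energy_add_le[OF f h d])
      also have "\<dots> \<le> ennreal (1 + d) * ennreal r + ennreal (1 + 1 / d) * ennreal (C * (LINT x|lborel. (cmod (?h x))\<^sup>2))"
        unfolding r(1) by (intro add_left_mono mult_left_mono le[OF h]) simp
      also have "\<dots> = ennreal ((1 + d) * r + (1 + 1 / d) * (C * (LINT x|lborel. (cmod (f x - g n x))\<^sup>2)))"
        using d r(2) C unfolding hN by (simp add: ennreal_mult[symmetric] ennreal_plus[symmetric] del: ennreal_plus)
      finally show "C * (LINT x|lborel. (cmod (g n x))\<^sup>2)
        \<le> (1 + d) * r + (1 + 1 / d) * (C * (LINT x|lborel. (cmod (f x - g n x))\<^sup>2))"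
        using d r(2) C by (subst (asm) ennreal_le_iff) auto
    qed
  qed
  have "C * ?N \<le> r"
  proof (rule field_le_epsilon)
    fix e :: real assume e: "0 < e"
    \<comment> \<open>The denominator is \<open>r + 1\<close> since \<open>r\<close> may vanish.\<close>
    have "C * ?N \<le> (1 + e / (r + 1)) * r"
      using e r(2) by (intro lower) simp
    also have "\<dots> = r + e * (r / (r + 1))" by (simp add: field_simps)
    also have "\<dots> \<le> r + e * 1"
      using e r(2) by (intro add_left_mono mult_left_mono) auto
    finally show "C * ?N \<le> r + e" by simp
  qed
  with r show ?thesis by simp
qed

text \<open>Testing on a nonzero Schwartz function shows that the nonzero constant \<open>c\<close> is real and positive;
  the isometry then extends by density, with constant \<open>1 / c\<close>.\<close>

lemma calderon_admissible_imp_admissible: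
  assumes \<phi>: "\<phi> \<in> schwartz" and "calderon_admissible \<phi>"
  shows "admissible \<phi>"
proof -
  obtain c where c: "c \<noteq> 0" and lim: "\<And>g. g \<in> schwartz \<Longrightarrow>
      tempered_tendsto (\<lambda>(\<epsilon>, A). heis_conv g (calderon_kernel \<phi> \<epsilon> A)) (\<lambda>\<omega>. c * g \<omega>) (at_right 0 \<times>\<^sub>F at_top)"
    using assms(2) unfolding calderon_admissible_def by blast
  obtain g0 :: "heis \<Rightarrow> complex" where g0: "g0 \<in> schwartz" "0 < (LINT x|lborel. (cmod (g0 x))\<^sup>2)"
    by (rule exists_nonzero_schwartz)
  have "Im c = 0" "0 \<le> Re c"
    using energy_of_calderon_limit(2,3)[OF g0(1) lim[OF g0(1)]] g0(2) by (auto simp: zero_le_mult_iff)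
  with c have Re: "0 < Re c" by (auto simp: complex_eq_iff)
  have e: "energy f = ennreal (Re c * (LINT x|lborel. (cmod (f x))\<^sup>2))" if "f \<in> L2 lborel" for f
    by (rule energy_extends_to_L2[OF less_imp_le[OF Re] energy_of_calderon_limit(1)[OF _ lim] that])
  show ?thesis
    unfolding admissible_def
  proof (intro conjI exI[of _ "1 / Re c"] ballI)
    show "\<phi> \<in> L2 lborel" by (rule schwartz_L2[OF \<phi>])
    show "0 < 1 / Re c" using Re by simp
    fix f :: "heis \<Rightarrow> complex" assume f: "f \<in> L2 lborel"
    have pos: "0 \<le> Re c * (LINT x|lborel. (cmod (f x))\<^sup>2)" using Re by simp
    note V = L2_haar_G_of_energy[OF f e[OF f] pos]
    show "wavelet_transform \<phi> f \<in> L2 haar_G" by (rule V(1))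
    have fm [measurable]: "f \<in> borel_measurable borel"
      using L2_measurable[OF f] by simp
    have "(\<lambda>y. (cmod (wavelet_transform \<phi> f y))\<^sup>2) \<in> borel_measurable borel" by measurable
    from haar_G_iterated_integral[OF this L2_integrable[OF V(1)]]
    show "(L2_norm lborel f)\<^sup>2 = 1 / Re c * (LINT \<omega>|lborel. (LINT a:{0<..}|lborel.
                 (cmod (wavelet_transform \<phi> f (\<omega>, a)))\<^sup>2 * (1 / a ^ 5)))"
      using Re unfolding V(2) L2_norm_def by (simp add: field_simps)
  qed
qed

text \<open>The isometry polarises to a formula for inner products, whose integral over \<open>G\<close> converges
  absolutely, and the pairing with \<open>\<psi>\<close> is a truncation of that integral with \<open>cnj \<psi>\<close> as second
  function.\<close>

lemma admissible_imp_calderon_admissible: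
  assumes \<phi>: "\<phi> \<in> schwartz" and mean: "(LINT \<omega>|lborel. \<phi> \<omega>) = 0" and adm: "admissible \<phi>"
  shows "calderon_admissible \<phi>"
proof -
  obtain C where C: "C > 0" and V2: "\<And>f. f \<in> L2 lborel \<Longrightarrow> wavelet_transform \<phi> f \<in> L2 haar_G"
    and iso: "\<And>f. f \<in> L2 lborel \<Longrightarrow> (L2_norm lborel f)\<^sup>2 =
          C * (LINT \<omega>|lborel. (LINT a:{0<..}|lborel.
                 (cmod (wavelet_transform \<phi> f (\<omega>, a)))\<^sup>2 * (1 / a ^ 5)))"
    using adm unfolding admissible_def by blast
  have isometry: "(LINT x|lborel. (cmod (f x))\<^sup>2) = C * (LINT y|haar_G. (cmod (wavelet_transform \<phi> f y))\<^sup>2)"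
    if f: "f \<in> L2 lborel" for f
  proof -
    have [measurable]: "f \<in> borel_measurable borel"
      using L2_measurable[OF f] by simp
    have "(\<lambda>y. (cmod (wavelet_transform \<phi> f y))\<^sup>2) \<in> borel_measurable borel" by measurable
    from haar_G_iterated_integral[OF this L2_integrable[OF V2[OF f]]] iso[OF f]
    show ?thesis by (simp add: L2_norm_def)
  qed
  have inner: "(LINT x|lborel. f x * cnj (g x))
      = of_real C * (LINT y|haar_G. wavelet_transform \<phi> f y * cnj (wavelet_transform \<phi> g y))"
    if f: "f \<in> L2 lborel" and g: "g \<in> L2 lborel" for f g
  proof -
    have E: "(LINT x|lborel. (cmod (f x + c * g x))\<^sup>2)
        = C * (LINT y|haar_G. (cmod (wavelet_transform \<phi> f y + c * wavelet_transform \<phi> g y))\<^sup>2)" for c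
    proof -
      have "(LINT y|haar_G. (cmod (wavelet_transform \<phi> (\<lambda>x. f x + c * g x) y))\<^sup>2)
          = (LINT y|haar_G. (cmod (wavelet_transform \<phi> f y + c * wavelet_transform \<phi> g y))\<^sup>2)"
        by (rule Bochner_Integration.integral_cong[OF refl])
          (auto simp: space_haar_G wavelet_transform_add_cmult[OF f g])
      then show ?thesis
        using isometry[OF L2_add[OF f L2_cmult[OF g]]] by simp
    qed
    have "4 * (LINT x|lborel. f x * cnj (g x))
      = 4 * (of_real C * (LINT y|haar_G. wavelet_transform \<phi> f y * cnj (wavelet_transform \<phi> g y)))"
      unfolding mult.left_commute[of 4] L2_polarization[OF f g] L2_polarization[OF V2[OF f] V2[OF g]] E
      by (simp add: algebra_simps)
    then show ?thesis by simp
  qed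
  show ?thesis
    unfolding calderon_admissible_def
  proof (intro conjI exI[of _ "complex_of_real (1 / C)"] ballI \<phi> mean)
    show "complex_of_real (1 / C) \<noteq> 0" using C by simp
    fix g :: "heis \<Rightarrow> complex" assume g: "g \<in> schwartz"
    show "tempered_tendsto (\<lambda>(\<epsilon>, A). heis_conv g (calderon_kernel \<phi> \<epsilon> A))
        (\<lambda>\<omega>. complex_of_real (1 / C) * g \<omega>) (at_right 0 \<times>\<^sub>F at_top)"
      unfolding tempered_tendsto_def
    proof
      fix \<psi> :: "heis \<Rightarrow> complex" assume \<psi>: "\<psi> \<in> schwartz"
      let ?h = "\<lambda>y. wavelet_transform \<phi> g y * cnj (wavelet_transform \<phi> (\<lambda>x. cnj (\<psi> x)) y)"
      have gL: "g \<in> L2 lborel" and \<psi>L: "(\<lambda>x. cnj (\<psi> x)) \<in> L2 lborel"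
        by (rule schwartz_L2[OF g], rule schwartz_L2[OF schwartz_cnj[OF \<psi>]])
      have h: "integrable haar_G ?h"
        by (rule L2_mult_cnj_integrable[OF V2[OF gL] V2[OF \<psi>L]])
      have "(LINT x|lborel. complex_of_real (1 / C) * g x * \<psi> x) = (LINT y|haar_G. ?h y)"
        using inner[OF gL \<psi>L] C by (simp add: mult.assoc)
      then have lim: "((\<lambda>(\<epsilon>, A). LINT y|haar_G. indicator {\<epsilon>..A} (snd y) *\<^sub>R ?h y)
          \<longlongrightarrow> (LINT x|lborel. complex_of_real (1 / C) * g x * \<psi> x)) (at_right 0 \<times>\<^sub>F at_top)"
        using truncated_integral_tendsto[OF h] by simp
      have "\<forall>\<^sub>F i in at_right (0 :: real) \<times>\<^sub>F (at_top :: real filter). 0 < fst i \<and> True"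
        by (rule eventually_prodI[OF eventually_at_right_less]) simp
      then have "\<forall>\<^sub>F i in at_right (0 :: real) \<times>\<^sub>F at_top.
          (case i of (\<epsilon>, A) \<Rightarrow> LINT y|haar_G. indicator {\<epsilon>..A} (snd y) *\<^sub>R ?h y)
          = (LINT x|lborel. (case i of (\<epsilon>, A) \<Rightarrow> heis_conv g (calderon_kernel \<phi> \<epsilon> A)) x * \<psi> x)"
      proof eventually_elim
        case (elim i)
        then show ?case
          using calderon_kernel_pairing_haar[OF _ schwartz_integrable[OF g] schwartz_integrable[OF \<psi>]]
          by (cases i) simp
      qed
      with lim show "((\<lambda>i. LINT x|lborel. (case i of (\<epsilon>, A) \<Rightarrow> heis_conv g (calderon_kernel \<phi> \<epsilon> A)) x * \<psi> x)
          \<longlongrightarrow> (LINT x|lborel. complex_of_real (1 / C) * g x * \<psi> x)) (at_right 0 \<times>\<^sub>F at_top)"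
        by (rule Lim_transform_eventually)
    qed
  qed
qed

end

theorem theorem2p2:
  fixes \<phi> :: "heis \<Rightarrow> complex"
  assumes "\<phi> \<in> schwartz"
    and "(LINT \<omega>|lborel. \<phi> \<omega>) = 0"
  shows "admissible \<phi> \<longleftrightarrow> calderon_admissible \<phi>"
proof -
  obtain M where "\<And>x. norm (\<phi> x) \<le> M"
    using schwartz_bounded[OF assms(1)] by blast
  then interpret integrable_wavelet \<phi> M
    using schwartz_integrable[OF assms(1)] by unfold_locales
  show ?thesis
    using admissible_imp_calderon_admissible[OF assms] calderon_admissible_imp_admissible[OF assms(1)] by blast
qed

end
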